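(* Let $1\le p\le n$, let $A_1,\dots,A_N$ be real symmetric $n\times n$ matrices, and let $f(Y)=-\sum_{l=1}^N\|\operatorname{diag}(Y^TA_lY)\|_F^2$ on $\mathrm{St}(p,n)$, endowed with the metric induced from $\mathbb R^{n\times p}$. Let $Y\in\mathrm{St}(p,n)$ and let $Y_\perp\in\mathbb R^{n\times(n-p)}$ satisfy $Y^TY_\perp=0$ and $Y_\perp^TY_\perp=I_{n-p}$. Put $Z_l=Y^TA_lY$, $Z_l^{\perp}=Y^TA_lY_\perp$, $Z_l^{\perp\perp}=Y_\perp^TA_lY_\perp$, and let $H_A=\begin{pmatrix}H_{11}&H_{12}\\H_{21}&H_{22}\end{pmatrix}$ with $$H_{11}=-2D_p^T\sum_{l=1}^N\Bigl(\operatorname{diag}(Z_l)\otimes Z_l+2(I_p\otimes Z_l)\Delta_p(I_p\otimes Z_l)-\operatorname{sym}(Z_l\operatorname{diag}(Z_l))\otimes I_p\Bigr)D_p,$$ $$H_{12}=-2D_p^T\sum_{l=1}^N\Bigl(\operatorname{diag}(Z_l)\otimes Z_l^{\perp}+2(I_p\otimes Z_l)\Delta_p(I_p\otimes Z_l^{\perp})\Bigr),$$ $$H_{21}=-4\sum_{l=1}^N\Bigl(\operatorname{diag}(Z_l)\otimes (Z_l^{\perp})^T+2(I_p\otimes (Z_l^{\perp})^T)\Delta_p(I_p\otimes Z_l)\Bigr)D_p,$$ $$H_{22}=-4\sum_{l=1}^N\Bigl(\operatorname{diag}(Z_l)\otimes Z_l^{\perp\perp}+2(I_p\otimes (Z_l^{\perp})^T)\Delta_p(I_p\otimes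 Z_l^{\perp})-\operatorname{sym}(Z_l\operatorname{diag}(Z_l))\otimes I_{n-p}\Bigr).$$ Then a tangent vector $\xi=YB+Y_\perp C\in T_Y\mathrm{St}(p,n)$, with $B\in\mathrm{Skew}(p)$ and $C\in\mathbb R^{(n-p)\times p}$, solves Newton's equation $\operatorname{Hess}f(Y)[\xi]=-\operatorname{grad}f(Y)$ if and only if $$H_A\begin{pmatrix}\operatorname{veck}(B)\\ \operatorname{vec}(C)\end{pmatrix}=-\begin{pmatrix}\operatorname{veck}(Y^T\operatorname{grad}f(Y))\\ \operatorname{vec}(Y_\perp^T\operatorname{grad}f(Y))\end{pmatrix}.$$ In particular, if $H_A$ is invertible, the solution of Newton's equation is $\xi=YB+Y_\perp C$ where $$\begin{pmatrix}\operatorname{veck}(B)\\ \operatorname{vec}(C)\end{pmatrix}=-H_A^{-1}\begin{pmatrix}\operatorname{veck}(Y^T\operatorname{grad}f(Y))\\ \operatorname{vec}(Y_\perp^T\operatorname{grad}f(Y))\end{pmatrix}.$$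
   Context: $\mathrm{St}(p,n)=\{Y\in\mathbb R^{n\times p}: Y^TY=I_p\}$ is regarded as a Riemannian submanifold of $\mathbb R^{n\times p}$ with metric $\langle\xi_1,\xi_2\rangle_Y=\operatorname{tr}(\xi_1^T\xi_2)$. Its tangent space is $T_Y\mathrm{St}(p,n)=\{\xi\in\mathbb R^{n\times p}:\xi^TY+Y^T\xi=0\}=\{YB+Y_\perp C: B\in\mathrm{Skew}(p),\ C\in\mathbb R^{(n-p)\times p}\}$, where $\mathrm{Skew}(p)$ is the set of real skew-symmetric $p\times p$ matrices, and the orthogonal projection onto it is $P_Y(W)=W-Y\operatorname{sym}(Y^TW)$. The Riemannian gradient and Hessian of $f$ are $$\operatorname{grad}f(Y)=P_Y\Bigl(-4\sum_{l=1}^NA_lY\operatorname{diag}(Y^TA_lY)\Bigr),$$ $$\operatorname{Hess}f(Y)[\xi]=-4\sum_{l=1}^NP_Y\Bigl(A_l\xi\operatorname{diag}(Y^TA_lY)+2A_lY\operatorname{diag}(Y^TA_l\xi)-\xi\operatorname{sym}(Y^TA_lY\operatorname{diag}(Y^TA_lY))\Bigr).$$ For a square matrix $W=(w_{ij})$: $\operatorname{sym}(W)=(W+W^T)/2$ and $\operatorname{diag}(W)$ is the diagonal matrix with the same diagonal as $W$. $\|\cdot\|_F$ is the Frobenius norm and $\otimes$ is the Kronecker product. $\operatorname{vec}(W)$ stacks the columns of $W$ vertically. For a skew-symmetric $m\times m$ matrix $S=(s_{ij})$, $\operatorname{veck}(S)=(s_{21},\dots,s_{m1},s_{32},\dots,s_{m2},\dots,s_{m,m-1})^T\in\mathbb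 R^{m(m-1)/2}$. $E^{(a\times b)}_{ij}$ is the $a\times b$ matrix with $(i,j)$ entry $1$ and all other entries $0$. $\Delta_m=\sum_{i=1}^m E^{(m\times m)}_{ii}\otimes E^{(m\times m)}_{ii}$. $D_m$ is the $m^2\times m(m-1)/2$ matrix $$D_m=\sum_{m\ge i>j\ge1}\Bigl(E^{(m^2\times m(m-1)/2)}_{m(j-1)+i,\ j(m-(j+1)/2)-m+i}-E^{(m^2\times m(m-1)/2)}_{m(i-1)+j,\ j(m-(j+1)/2)-m+i}\Bigr),$$ so that $\operatorname{vec}(S)=D_m\operatorname{veck}(S)$ for every skew-symmetric $m\times m$ matrix $S$. If $p=n$, $Y_\perp$ and $C$ are empty and only the block $H_{11}$ is present. *)

theory Defs
  imports Complex_Main "Jordan_Normal_Form.Gauss_Jordan_Elimination"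
begin

text \<open>Entrywise sum of a family of matrices of known format; the format is explicit so that the
  empty sum is the zero matrix of the right size.\<close>

definition msum :: "nat \<Rightarrow> nat \<Rightarrow> ('i \<Rightarrow> real mat) \<Rightarrow> 'i set \<Rightarrow> real mat" where
  "msum r c F S = mat r c (\<lambda>ij. \<Sum>s\<in>S. F s $$ ij)"

definition mtrace :: "real mat \<Rightarrow> real" where
  "mtrace W = (\<Sum>i<dim_row W. W $$ (i, i))"

definition frob_norm :: "real mat \<Rightarrow> real" where
  "frob_norm W = sqrt (\<Sum>i<dim_row W. \<Sum>j<dim_col W. (W $$ (i, j))\<^sup>2)"

definition sym_part :: "real mat \<Rightarrow> real mat" where
  "sym_part W = (1/2) \<cdot>\<^sub>m (W + W\<^sup>T)"

definition diag_part :: "real mat \<Rightarrow> real mat" where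
  "diag_part W = mat_diag (dim_row W) (\<lambda>i. W $$ (i, i))"

definition skew_mats :: "nat \<Rightarrow> real mat set" where
  "skew_mats m = {S \<in> carrier_mat m m. S\<^sup>T = - S}"

definition kron :: "real mat \<Rightarrow> real mat \<Rightarrow> real mat" (infixl "\<otimes>\<^sub>k" 75) where
  "P \<otimes>\<^sub>k Q = mat (dim_row P * dim_row Q) (dim_col P * dim_col Q)
     (\<lambda>(i, j). P $$ (i div dim_row Q, j div dim_col Q) * Q $$ (i mod dim_row Q, j mod dim_col Q))"

definition mvec :: "real mat \<Rightarrow> real vec" where
  "mvec W = vec (dim_row W * dim_col W) (\<lambda>k. W $$ (k mod dim_row W, k div dim_row W))"

definition veck :: "real mat \<Rightarrow> real vec" where
  "veck S = vec_of_list
     (concat (map (\<lambda>j. map (\<lambda>i. S $$ (i, j)) [Suc j..<dim_row S]) [0..<dim_col S]))"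

text \<open>The indices \<open>i, j\<close> of \<open>Emat a b i j\<close> are counted from 1, those of \<open>$$\<close> from 0.\<close>

definition Emat :: "nat \<Rightarrow> nat \<Rightarrow> nat \<Rightarrow> nat \<Rightarrow> real mat" where
  "Emat a b i j = mat a b (\<lambda>(r, c). if Suc r = i \<and> Suc c = j then 1 else 0)"

definition Delta :: "nat \<Rightarrow> real mat" where
  "Delta m = msum (m * m) (m * m) (\<lambda>i. Emat m m i i \<otimes>\<^sub>k Emat m m i i) {1..m}"

text \<open>The column index \<open>j (m - (j + 1) / 2) - m + i\<close> is reordered so that, for
  \<open>m \<ge> i > j \<ge> 1\<close>, no subtraction on \<open>nat\<close> truncates.\<close>

definition Dmat :: "nat \<Rightarrow> real mat" where
  "Dmat m = msum (m * m) (m * (m - 1) div 2)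
     (\<lambda>(i, j). let k = (j * m + i) - (j * (j + 1)) div 2 - m in
        Emat (m * m) (m * (m - 1) div 2) (m * (j - 1) + i) k
        - Emat (m * m) (m * (m - 1) div 2) (m * (i - 1) + j) k)
     {(i, j). m \<ge> i \<and> i > j \<and> j \<ge> 1}"

definition stiefel :: "nat \<Rightarrow> nat \<Rightarrow> real mat set" where
  "stiefel p n = {Y \<in> carrier_mat n p. Y\<^sup>T * Y = 1\<^sub>m p}"

definition tangent :: "nat \<Rightarrow> nat \<Rightarrow> real mat \<Rightarrow> real mat set" where
  "tangent p n Y = {\<xi> \<in> carrier_mat n p. \<xi>\<^sup>T * Y + Y\<^sup>T * \<xi> = 0\<^sub>m p p}"

definition metric :: "real mat \<Rightarrow> real mat \<Rightarrow> real" where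
  "metric \<xi> \<eta> = mtrace (\<xi>\<^sup>T * \<eta>)"

definition proj :: "real mat \<Rightarrow> real mat \<Rightarrow> real mat" where
  "proj Y W = W - Y * sym_part (Y\<^sup>T * W)"

definition has_mat_derivative ::
    "nat \<Rightarrow> nat \<Rightarrow> (real \<Rightarrow> real mat) \<Rightarrow> real mat \<Rightarrow> real \<Rightarrow> bool" where
  "has_mat_derivative r c \<gamma> V t \<longleftrightarrow> V \<in> carrier_mat r c \<and>
     (\<forall>i<r. \<forall>j<c. ((\<lambda>s. \<gamma> s $$ (i, j)) has_real_derivative V $$ (i, j)) (at t))"

definition stiefel_curve ::
    "nat \<Rightarrow> nat \<Rightarrow> real mat \<Rightarrow> real mat \<Rightarrow> (real \<Rightarrow> real mat) \<Rightarrow> bool" where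
  "stiefel_curve p n Y \<xi> \<gamma> \<longleftrightarrow>
     (\<forall>t. \<gamma> t \<in> stiefel p n) \<and> \<gamma> 0 = Y \<and> has_mat_derivative n p \<gamma> \<xi> 0"

text \<open>The gradient is the tangent vector that represents the differential of \<open>f\<close> with respect to
  the metric; the differential is taken along curves in the manifold.\<close>

definition rgrad :: "nat \<Rightarrow> nat \<Rightarrow> (real mat \<Rightarrow> real) \<Rightarrow> real mat \<Rightarrow> real mat" where
  "rgrad p n f Y = (THE g. g \<in> tangent p n Y \<and>
     (\<forall>\<xi>\<in>tangent p n Y. \<forall>\<gamma>. stiefel_curve p n Y \<xi> \<gamma> \<longrightarrow>
        ((\<lambda>t. f (\<gamma> t)) has_real_derivative metric g \<xi>) (at 0)))"

text \<open>The Hessian is the covariant derivative of the gradient field. The Levi-Civita connection of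
  a Riemannian submanifold of Euclidean space is the tangential projection of the ordinary
  derivative, which only depends on the field along a curve with velocity \<open>\<xi>\<close>.\<close>

definition rhess ::
    "nat \<Rightarrow> nat \<Rightarrow> (real mat \<Rightarrow> real) \<Rightarrow> real mat \<Rightarrow> real mat \<Rightarrow> real mat" where
  "rhess p n f Y \<xi> = (THE \<eta>.
     \<forall>\<gamma>. stiefel_curve p n Y \<xi> \<gamma> \<longrightarrow>
       (\<exists>V. has_mat_derivative n p (\<lambda>t. rgrad p n f (\<gamma> t)) V 0 \<and> \<eta> = proj Y V))"

definition jd_cost :: "nat \<Rightarrow> (nat \<Rightarrow> real mat) \<Rightarrow> real mat \<Rightarrow> real" where
  "jd_cost N A Y = - (\<Sum>l\<in>{1..N}. (frob_norm (diag_part (Y\<^sup>T * A l * Y)))\<^sup>2)"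

text \<open>Below, \<open>q\<close> is \<open>n - p\<close>, and \<open>Z\<close>, \<open>Zp\<close>, \<open>Zpp\<close> are the families
  of products of \<open>A l\<close> with zero, one and two factors \<open>Yp\<close>.\<close>

definition H11 :: "nat \<Rightarrow> nat \<Rightarrow> (nat \<Rightarrow> real mat) \<Rightarrow> real mat" where
  "H11 p N Z = (-2) \<cdot>\<^sub>m ((Dmat p)\<^sup>T *
     msum (p * p) (p * p) (\<lambda>l. diag_part (Z l) \<otimes>\<^sub>k Z l
       + 2 \<cdot>\<^sub>m ((1\<^sub>m p \<otimes>\<^sub>k Z l) * Delta p * (1\<^sub>m p \<otimes>\<^sub>k Z l))
       - sym_part (Z l * diag_part (Z l)) \<otimes>\<^sub>k 1\<^sub>m p) {1..N} * Dmat p)"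

definition H12 :: "nat \<Rightarrow> nat \<Rightarrow> nat \<Rightarrow> (nat \<Rightarrow> real mat) \<Rightarrow> (nat \<Rightarrow> real mat) \<Rightarrow> real mat" where
  "H12 p q N Z Zp = (-2) \<cdot>\<^sub>m ((Dmat p)\<^sup>T *
     msum (p * p) (p * q) (\<lambda>l. diag_part (Z l) \<otimes>\<^sub>k Zp l
       + 2 \<cdot>\<^sub>m ((1\<^sub>m p \<otimes>\<^sub>k Z l) * Delta p * (1\<^sub>m p \<otimes>\<^sub>k Zp l))) {1..N})"

definition H21 :: "nat \<Rightarrow> nat \<Rightarrow> nat \<Rightarrow> (nat \<Rightarrow> real mat) \<Rightarrow> (nat \<Rightarrow> real mat) \<Rightarrow> real mat" where
  "H21 p q N Z Zp = (-4) \<cdot>\<^sub>m (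
     msum (p * q) (p * p) (\<lambda>l. diag_part (Z l) \<otimes>\<^sub>k (Zp l)\<^sup>T
       + 2 \<cdot>\<^sub>m ((1\<^sub>m p \<otimes>\<^sub>k (Zp l)\<^sup>T) * Delta p * (1\<^sub>m p \<otimes>\<^sub>k Z l))) {1..N} * Dmat p)"

definition H22 :: "nat \<Rightarrow> nat \<Rightarrow> nat \<Rightarrow> (nat \<Rightarrow> real mat) \<Rightarrow> (nat \<Rightarrow> real mat) \<Rightarrow>
    (nat \<Rightarrow> real mat) \<Rightarrow> real mat" where
  "H22 p q N Z Zp Zpp = (-4) \<cdot>\<^sub>m
     msum (p * q) (p * q) (\<lambda>l. diag_part (Z l) \<otimes>\<^sub>k Zpp l
       + 2 \<cdot>\<^sub>m ((1\<^sub>m p \<otimes>\<^sub>k (Zp l)\<^sup>T) * Delta p * (1\<^sub>m p \<otimes>\<^sub>k Zp l))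
       - sym_part (Z l * diag_part (Z l)) \<otimes>\<^sub>k 1\<^sub>m q) {1..N}"

text \<open>For \<open>p = n\<close> the blocks other than \<open>H11\<close> have no rows or no columns, so this is \<open>H11\<close>.\<close>

definition HA :: "nat \<Rightarrow> nat \<Rightarrow> nat \<Rightarrow> (nat \<Rightarrow> real mat) \<Rightarrow> real mat \<Rightarrow> real mat \<Rightarrow> real mat" where
  "HA p n N A Y Yp =
     (let q = n - p;
          Z = (\<lambda>l. Y\<^sup>T * A l * Y);
          Zp = (\<lambda>l. Y\<^sup>T * A l * Yp);
          Zpp = (\<lambda>l. Yp\<^sup>T * A l * Yp)
      in four_block_mat (H11 p N Z) (H12 p q N Z Zp) (H21 p q N Z Zp) (H22 p q N Z Zp Zpp))"

end

(* Along a curve in the manifold, f differentiates to the pairing with the Euclidean gradient E, so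
   grad f = P_Y E; differentiating this field and projecting removes the term Y sym(...), which
   leaves Hess f(Y)[\<xi>] = P_Y(DE[\<xi>] - \<xi> sym(Y\<^sup>TE)). Both statements need a curve through every
   tangent vector, which a Cayley transform provides. Since [Y Y\<^sub>\<bottom>] is orthogonal, Newton's equation
   is equivalent to its two components Y\<^sup>T(...) (skew-symmetric) and Y\<^sub>\<bottom>\<^sup>T(...). These are vectorised by
   vec(PXQ) = (Q\<^sup>T \<otimes> P) vec X, \<Delta> vec W = vec(diag W), D veck S = vec S and
   D\<^sup>T vec W = veck(W - W\<^sup>T); the last one turns the factor -4 into -2 in the upper blocks. *)

theory Submission
  imports Defs "Jordan_Normal_Form.Determinant"
begin

text \<open>\<open>rgrad\<close> and \<open>rhess\<close> are definite descriptions quantified over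
  all curves with a given velocity. A closed formula therefore needs uniqueness as well as
  existence: for a velocity that no curve realises, the defining condition would hold vacuously.
  This is why a curve has to be constructed for every tangent vector. The Cayley transform suits
  this purpose because its orthogonality is a purely algebraic identity and the only analysis left
  is continuity at 0; no matrix power series occurs. The term Y sym(...) disappears because Y S with
  S symmetric is normal to the manifold, so P_Y annihilates it. The constant -2 of the upper blocks
  is -4 times the 1/2 in Y^T P_Y W = (Y^T W - W^T Y)/2, while D^T contributes the difference of a
  matrix and its transpose without that half. Before projection the Y-component of the Hessian is in
  general not skew-symmetric, so it has to be antisymmetrised; the other component passes through
  P_Y unchanged. The clash between 1-based \<open>Emat\<close> and 0-based entries is settled by an
  explicit numbering of the strictly lower triangle.\<close>

section \<open>Matrix algebra and entrywise derivatives\<close>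

text \<open>The distributive and associative laws of the library have carrier premises whose formats the
  simplifier would have to guess; with dimension premises they can be used as rewrite rules.\<close>

lemma mult_assoc_dim:
  "dim_col A = dim_row B \<Longrightarrow> dim_col B = dim_row C \<Longrightarrow> A * B * C = A * (B * (C :: real mat))"
  by (rule assoc_mult_mat[of _ "dim_row A" "dim_row B" _ "dim_row C" _ "dim_col C"]) auto

lemma mult_add_dim:
  "dim_col A = dim_row B \<Longrightarrow> dim_row B = dim_row C \<Longrightarrow> dim_col B = dim_col C \<Longrightarrow>
    A * (B + C) = A * B + A * (C :: real mat)"
  by (rule mult_add_distrib_mat[of _ "dim_row A" "dim_row B" _ "dim_col C"]) auto

lemma add_mult_dim:
  "dim_col A = dim_row C \<Longrightarrow> dim_row A = dim_row B \<Longrightarrow> dim_col A = dim_col B \<Longrightarrow>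
    (A + B) * C = A * C + B * (C :: real mat)"
  by (rule add_mult_distrib_mat[of _ "dim_row A" "dim_row C" _ _ "dim_col C"]) auto

lemma mult_minus_dim:
  "dim_col A = dim_row B \<Longrightarrow> dim_row B = dim_row C \<Longrightarrow> dim_col B = dim_col C \<Longrightarrow>
    A * (B - C) = A * B - A * (C :: real mat)"
  by (rule mult_minus_distrib_mat[of _ "dim_row A" "dim_row B" _ "dim_col C"]) auto

lemma minus_mult_dim:
  "dim_col A = dim_row C \<Longrightarrow> dim_row A = dim_row B \<Longrightarrow> dim_col A = dim_col B \<Longrightarrow>
    (A - B) * C = A * C - B * (C :: real mat)"
  by (rule minus_mult_distrib_mat[of _ "dim_row A" "dim_row C" _ _ "dim_col C"]) auto

lemma mult_smult_dim:
  "dim_col A = dim_row B \<Longrightarrow> A * (k \<cdot>\<^sub>m B) = k \<cdot>\<^sub>m (A * (B :: real mat))"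
  by (rule mult_smult_distrib[of _ "dim_row A" "dim_row B" _ "dim_col B"]) auto

lemma smult_mult_dim:
  "dim_col A = dim_row B \<Longrightarrow> (k \<cdot>\<^sub>m A) * B = k \<cdot>\<^sub>m (A * (B :: real mat))"
  by (rule mult_smult_assoc_mat[of _ "dim_row A" "dim_row B" _ "dim_col B"]) auto

lemma transpose_mult_dim:
  "dim_col A = dim_row B \<Longrightarrow> (A * B)\<^sup>T = (B :: real mat)\<^sup>T * A\<^sup>T"
  by (rule transpose_mult[of _ "dim_row A" "dim_row B" _ "dim_col B"]) auto

lemma transpose_add_dim:
  "dim_row A = dim_row B \<Longrightarrow> dim_col A = dim_col B \<Longrightarrow> (A + B)\<^sup>T = A\<^sup>T + (B :: real mat)\<^sup>T"
  by (rule transpose_add[of _ "dim_row A" "dim_col A"]) auto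

lemma transpose_minus_dim:
  "dim_row A = dim_row B \<Longrightarrow> dim_col A = dim_col B \<Longrightarrow> (A - B)\<^sup>T = A\<^sup>T - (B :: real mat)\<^sup>T"
  by (rule transpose_minus[of _ "dim_row A" "dim_col A"]) auto

lemma transpose_smult: "(k \<cdot>\<^sub>m A)\<^sup>T = k \<cdot>\<^sub>m (A :: real mat)\<^sup>T"
  by (rule eq_matI) auto

lemma left_one_dim: "dim_row A = n \<Longrightarrow> 1\<^sub>m n * A = (A :: real mat)"
  by (rule left_mult_one_mat[of _ n "dim_col A"]) auto

lemma right_one_dim: "dim_col A = n \<Longrightarrow> A * 1\<^sub>m n = (A :: real mat)"
  by (rule right_mult_one_mat[of _ "dim_row A" n]) auto

lemmas mat_laws = mult_assoc_dim mult_add_dim add_mult_dim mult_minus_dim minus_mult_dim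
  mult_smult_dim smult_mult_dim transpose_mult_dim transpose_add_dim transpose_minus_dim
  transpose_smult left_one_dim right_one_dim

text \<open>Takes the place of the library rule \<open>index_mult_mat(1)\<close>, which opens an
  entry of a product into a scalar product of a row and a column. That rule is deleted from many
  simp calls below, so that entries of products stay atomic or become sums over one index.\<close>

lemma index_mult_sum:
  "i < dim_row A \<Longrightarrow> j < dim_col B \<Longrightarrow> dim_col A = dim_row B \<Longrightarrow>
    (A * B) $$ (i, j) = (\<Sum>k<dim_row B. A $$ (i, k) * (B :: real mat) $$ (k, j))"
  by (simp add: scalar_prod_def atLeast0LessThan)

lemma msum_dim [simp]: "dim_row (msum r c F S) = r" "dim_col (msum r c F S) = c"
  by (simp_all add: msum_def)

lemma msum_index: "i < r \<Longrightarrow> j < c \<Longrightarrow> msum r c F S $$ (i, j) = (\<Sum>s\<in>S. F s $$ (i, j))"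
  by (simp add: msum_def)

lemma msum_cong:
  "(\<And>s. s \<in> S \<Longrightarrow> F s = G s) \<Longrightarrow> msum r c F S = msum r c G S"
  by (simp add: msum_def cong: sum.cong)

lemma mult_msum:
  assumes "dim_col P = r" "\<And>s. s \<in> S \<Longrightarrow> F s \<in> carrier_mat r c"
  shows "P * msum r c F S = msum (dim_row P) c (\<lambda>s. P * F s) S"
proof (rule eq_matI, goal_cases)
  case (1 i j)
  hence "(P * msum r c F S) $$ (i, j) = (\<Sum>k<r. \<Sum>s\<in>S. P $$ (i, k) * F s $$ (k, j))"
    using assms by (simp add: index_mult_sum msum_index sum_distrib_left del: index_mult_mat(1))
  also have "\<dots> = (\<Sum>s\<in>S. \<Sum>k<r. P $$ (i, k) * F s $$ (k, j))" by (rule sum.swap)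
  also have "\<dots> = (\<Sum>s\<in>S. (P * F s) $$ (i, j))"
    using assms 1 by (intro sum.cong refl, subst index_mult_sum) force+
  finally show ?case using 1 by (simp add: msum_index)
qed auto

lemma diag_part_dim [simp]: "dim_row (diag_part W) = dim_row W" "dim_col (diag_part W) = dim_row W"
  by (simp_all add: diag_part_def mat_diag_def)

lemma diag_part_index:
  "i < dim_row W \<Longrightarrow> j < dim_row W \<Longrightarrow> diag_part W $$ (i, j) = (if i = j then W $$ (i, i) else 0)"
  by (simp add: diag_part_def mat_diag_def)

lemma diag_part_transpose [simp]: "(diag_part W)\<^sup>T = diag_part W"
  by (rule eq_matI) (auto simp: diag_part_index)

lemma sym_part_dim [simp]:
  "dim_row (sym_part W) = dim_col W" "dim_col (sym_part W) = dim_row W"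
  by (simp_all add: sym_part_def)

lemma sym_part_index:
  "i < dim_row W \<Longrightarrow> j < dim_row W \<Longrightarrow> dim_col W = dim_row W \<Longrightarrow>
    sym_part W $$ (i, j) = (W $$ (i, j) + W $$ (j, i)) / 2"
  by (simp add: sym_part_def)

lemma sym_part_transpose:
  "dim_row W = dim_col W \<Longrightarrow> (sym_part W)\<^sup>T = sym_part W"
  by (rule eq_matI) (auto simp: sym_part_index)

section \<open>Derivatives of matrix-valued curves, entry by entry\<close>

lemma has_mat_derivativeD:
  "has_mat_derivative r c F F' t \<Longrightarrow> i < r \<Longrightarrow> j < c \<Longrightarrow>
    ((\<lambda>s. F s $$ (i, j)) has_real_derivative F' $$ (i, j)) (at t)"
  "has_mat_derivative r c F F' t \<Longrightarrow> F' \<in> carrier_mat r c"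
  by (simp_all add: has_mat_derivative_def)

lemma has_mat_derivative_unique:
  assumes "has_mat_derivative r c F V t" "has_mat_derivative r c F W t"
  shows "V = W"
  using assms by (intro eq_matI) (auto simp: has_mat_derivative_def, blast intro: DERIV_unique)

lemma has_mat_derivative_const:
  "K \<in> carrier_mat r c \<Longrightarrow> has_mat_derivative r c (\<lambda>s. K) (0\<^sub>m r c) t"
  by (simp add: has_mat_derivative_def)

text \<open>The formats are required at every \<open>s\<close>, not only at \<open>t\<close>: an
  entry of \<open>F s * G s\<close> has to be a sum over the same \<open>k\<close> indices for all
  \<open>s\<close> before it can be differentiated termwise.\<close>

lemma has_mat_derivative_mult:
  assumes F: "\<And>s. F s \<in> carrier_mat r k" and G: "\<And>s. G s \<in> carrier_mat k c"
    and "has_mat_derivative r k F F' t" and "has_mat_derivative k c G G' t"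
  shows "has_mat_derivative r c (\<lambda>s. F s * G s) (F' * G t + F t * G') t"
  unfolding has_mat_derivative_def
proof (intro conjI allI impI)
  note D = has_mat_derivativeD[OF assms(3)] has_mat_derivativeD[OF assms(4)]
  show "F' * G t + F t * G' \<in> carrier_mat r c"
    using D(2,4) F[of t] G[of t] by auto
  fix i j assume ij: "i < r" "j < c"
  have dims [simp]: "dim_row (F s) = r" "dim_col (F s) = k" "dim_row (G s) = k" "dim_col (G s) = c"
    "dim_row F' = r" "dim_col F' = k" "dim_row G' = k" "dim_col G' = c" for s
    using F G D by fastforce+
  have "((\<lambda>s. \<Sum>x<k. F s $$ (i, x) * G s $$ (x, j)) has_real_derivative
      (\<Sum>x<k. F' $$ (i, x) * G t $$ (x, j) + G' $$ (x, j) * F t $$ (i, x))) (at t)"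
    using D ij by (intro DERIV_sum DERIV_mult) auto
  thus "((\<lambda>s. (F s * G s) $$ (i, j)) has_real_derivative
      (F' * G t + F t * G') $$ (i, j)) (at t)"
    using ij by (simp add: index_mult_sum sum.distrib mult.commute del: index_mult_mat(1))
qed

lemma has_mat_derivative_transpose:
  assumes F: "\<And>s. F s \<in> carrier_mat r c" and "has_mat_derivative r c F F' t"
  shows "has_mat_derivative c r (\<lambda>s. (F s)\<^sup>T) (F'\<^sup>T) t"
proof -
  have [simp]: "dim_row (F s) = r" "dim_col (F s) = c" for s using F by fastforce+
  show ?thesis using assms(2) by (auto simp: has_mat_derivative_def)
qed

lemma has_mat_derivative_minus:
  assumes F: "\<And>s. F s \<in> carrier_mat r c" and G: "\<And>s. G s \<in> carrier_mat r c"
    and "has_mat_derivative r c F F' t" and "has_mat_derivative r c G G' t"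
  shows "has_mat_derivative r c (\<lambda>s. F s - G s) (F' - G') t"
proof -
  have [simp]: "dim_row (F s) = r" "dim_col (F s) = c" "dim_row (G s) = r" "dim_col (G s) = c" for s
    using F G by fastforce+
  show ?thesis using assms(3,4) by (auto simp: has_mat_derivative_def intro!: DERIV_diff)
qed

lemma has_mat_derivative_smult:
  assumes F: "\<And>s. F s \<in> carrier_mat r c" and "has_mat_derivative r c F F' t"
  shows "has_mat_derivative r c (\<lambda>s. a \<cdot>\<^sub>m F s) (a \<cdot>\<^sub>m F') t"
proof -
  have [simp]: "dim_row (F s) = r" "dim_col (F s) = c" for s using F by fastforce+
  show ?thesis using assms(2) by (auto simp: has_mat_derivative_def intro!: DERIV_cmult)
qed

lemma has_mat_derivative_msum:
  assumes "\<And>l. l \<in> S \<Longrightarrow> has_mat_derivative r c (F l) (F' l) t"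
  shows "has_mat_derivative r c (\<lambda>s. msum r c (\<lambda>l. F l s) S) (msum r c F' S) t"
  using assms by (auto simp: has_mat_derivative_def msum_index intro!: DERIV_sum carrier_matI)

lemma has_mat_derivative_diag_part:
  assumes F: "\<And>s. F s \<in> carrier_mat r r" and "has_mat_derivative r r F F' t"
  shows "has_mat_derivative r r (\<lambda>s. diag_part (F s)) (diag_part F') t"
proof -
  have [simp]: "dim_row (F s) = r" for s using F by fastforce
  show ?thesis using assms(2)
    by (auto simp: has_mat_derivative_def diag_part_index intro!: carrier_matI)
qed

lemma has_mat_derivative_sym_part:
  assumes F: "\<And>s. F s \<in> carrier_mat r r" and "has_mat_derivative r r F F' t"
  shows "has_mat_derivative r r (\<lambda>s. sym_part (F s)) (sym_part F') t"
proof -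
  have [simp]: "dim_row (F s) = r" "dim_col (F s) = r" for s using F by fastforce+
  show ?thesis using assms(2)
    by (auto simp: has_mat_derivative_def sym_part_index intro!: carrier_matI DERIV_cdivide DERIV_add)
qed

lemma stiefelD:
  assumes "Y \<in> stiefel p n"
  shows "Y \<in> carrier_mat n p" "dim_row Y = n" "dim_col Y = p" "Y\<^sup>T * Y = 1\<^sub>m p"
  using assms by (auto simp: stiefel_def)

lemma stiefel_curveD:
  assumes "stiefel_curve p n Y \<xi> \<gamma>"
  shows "\<gamma> t \<in> stiefel p n" "\<gamma> t \<in> carrier_mat n p" "dim_row (\<gamma> t) = n" "dim_col (\<gamma> t) = p"
    "\<gamma> 0 = Y" "has_mat_derivative n p \<gamma> \<xi> 0"
  using assms by (auto simp: stiefel_curve_def stiefel_def dest!: spec[of _ t])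

section \<open>Curves in the Stiefel manifold\<close>

text \<open>Exchanging the two summation indices turns the double sum into its own negative.\<close>

lemma skew_quadratic_form_zero:
  fixes w :: "nat \<Rightarrow> nat \<Rightarrow> real"
  assumes "\<And>i j. i < n \<Longrightarrow> j < n \<Longrightarrow> w j i = - w i j"
  shows "(\<Sum>i<n. \<Sum>j<n. x i * (w i j * x j)) = 0"
proof -
  have "(\<Sum>i<n. \<Sum>j<n. x i * (w i j * x j)) = (\<Sum>j<n. \<Sum>i<n. x i * (w i j * x j))"
    by (rule sum.swap)
  also have "\<dots> = (\<Sum>i<n. \<Sum>j<n. - (x i * (w i j * x j)))"
  proof (intro sum.cong refl)
    fix i j assume "i \<in> {..<n}" "j \<in> {..<n}"
    hence "w j i = - w i j" by (intro assms) auto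
    thus "x j * (w j i * x i) = - (x i * (w i j * x j))" by (simp only: mult_ac mult_minus_left mult_minus_right)
  qed
  finally show ?thesis by (simp add: sum_negf)
qed

lemma skew_index:
  "W\<^sup>T = - W \<Longrightarrow> W \<in> carrier_mat n n \<Longrightarrow> i < n \<Longrightarrow> j < n \<Longrightarrow> W $$ (j, i) = - (W $$ (i, j) :: real)"
  by (metis carrier_matD index_transpose_mat(1) index_uminus_mat(1))

text \<open>A kernel vector v satisfies v = s W v, so its squared norm is s times the quadratic form
  of W at v, which vanishes by skew-symmetry. Hence the determinant is nonzero for every real
  \<open>s\<close>, and the curve built from the inverse exists for all times.\<close>

lemma one_minus_skew_right_inverse:
  fixes W :: "real mat"
  assumes W: "W \<in> carrier_mat n n" and skew: "W\<^sup>T = - W"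
  shows "\<exists>R \<in> carrier_mat n n. (1\<^sub>m n - s \<cdot>\<^sub>m W) * R = 1\<^sub>m n"
proof -
  define M where "M = 1\<^sub>m n - s \<cdot>\<^sub>m W"
  have M: "M \<in> carrier_mat n n" using W by (auto simp: M_def)
  have "det M \<noteq> 0"
  proof
    assume "det M = 0"
    then obtain v where v: "v \<in> carrier_vec n" "v \<noteq> 0\<^sub>v n" "M *\<^sub>v v = 0\<^sub>v n"
      using det_0_iff_vec_prod_zero_field[OF M] by auto
    have fix_point: "v $ i = s * (\<Sum>j<n. W $$ (i, j) * v $ j)" if i: "i < n" for i
    proof -
      have "(M *\<^sub>v v) $ i = (\<Sum>j<n. (if i = j then v $ j else 0) - s * (W $$ (i, j) * v $ j))"
        using v(1) W M i by (auto simp: M_def scalar_prod_def atLeast0LessThan algebra_simps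
          intro!: sum.cong)
      also have "\<dots> = v $ i - s * (\<Sum>j<n. W $$ (i, j) * v $ j)"
        using i by (simp add: sum_subtractf sum_distrib_left)
      finally show ?thesis using v(3) i by simp
    qed
    have "(\<Sum>i<n. v $ i * v $ i) = (\<Sum>i<n. v $ i * (s * (\<Sum>j<n. W $$ (i, j) * v $ j)))"
      by (intro sum.cong refl) (simp flip: fix_point)
    also have "\<dots> = s * (\<Sum>i<n. \<Sum>j<n. v $ i * (W $$ (i, j) * v $ j))"
      by (simp add: sum_distrib_left algebra_simps)
    also have "\<dots> = 0"
      by (simp only: skew_quadratic_form_zero[OF skew_index[OF skew W]] mult_zero_right)
    finally have "\<forall>i<n. v $ i = 0"
      by (subst (asm) sum_nonneg_eq_0_iff) auto
    thus False using v by (auto simp: vec_eq_iff)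
  qed
  from det_non_zero_imp_unit[OF M this, of "()"] show ?thesis
    by (auto simp: Units_def ring_mat_def M_def)
qed

text \<open>Tangent vectors are infinitesimal rotations of Y. Subtracting half of Y Y^T \<xi> in
  \<open>U\<close> yields U^T Y = \<xi>^T Y / 2, so W Y = U - Y U^T Y = \<xi> - Y (Y^T \<xi> +
  \<xi>^T Y) / 2, and the bracket is zero by tangency.\<close>

lemma skew_tangent_generator:
  assumes Y: "Y \<in> stiefel p n" and xi: "\<xi> \<in> tangent p n Y"
  obtains W where "W \<in> carrier_mat n n" "W\<^sup>T = - W" "W * Y = \<xi>"
proof -
  note [simp] = stiefelD(2-4)[OF Y]
  have [simp]: "dim_row \<xi> = n" "dim_col \<xi> = p" and tan: "\<xi>\<^sup>T * Y + Y\<^sup>T * \<xi> = 0\<^sub>m p p"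
    using xi by (auto simp: tangent_def)
  define U where "U = \<xi> - (1/2) \<cdot>\<^sub>m (Y * (Y\<^sup>T * \<xi>))"
  have [simp]: "dim_row U = n" "dim_col U = p" by (simp_all add: U_def)
  define W where "W = U * Y\<^sup>T - Y * U\<^sup>T"
  have W: "W \<in> carrier_mat n n" by (auto simp: W_def)
  have "W\<^sup>T = - W"
    by (simp add: W_def mat_laws) (rule eq_matI, simp_all del: index_mult_mat(1))
  have UY: "U\<^sup>T * Y = (1/2) \<cdot>\<^sub>m (\<xi>\<^sup>T * Y)"
    by (simp add: U_def mat_laws) (rule eq_matI, simp_all del: index_mult_mat(1))
  have "Y * (\<xi>\<^sup>T * Y) + Y * (Y\<^sup>T * \<xi>) = Y * (\<xi>\<^sup>T * Y + Y\<^sup>T * \<xi>)"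
    by (simp add: mat_laws)
  also have "\<dots> = 0\<^sub>m n p" by (simp add: tan)
  finally have "(Y * (\<xi>\<^sup>T * Y)) $$ (i, j) + (Y * (Y\<^sup>T * \<xi>)) $$ (i, j) = 0" if "i < n" "j < p" for i j
    using that by (auto simp: mat_eq_iff simp del: index_mult_mat(1))
  note * = this
  have "U - (1/2) \<cdot>\<^sub>m (Y * (\<xi>\<^sup>T * Y)) = \<xi>"
  proof (rule eq_matI, goal_cases)
    case (1 i j)
    thus ?case using *[of i j] by (simp add: U_def del: index_mult_mat(1))
  qed auto
  hence "W * Y = \<xi>"
    by (simp add: W_def mat_laws UY)
  with that W \<open>W\<^sup>T = - W\<close> show ?thesis by blast
qed

text \<open>The curve is the orbit of \<open>Y\<close> under the Cayley transform \<open>2R - 1\<close>, \<open>R = (1 - (t/2)W)\<^sup>-\<^sup>1\<close>.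
  The identity \<open>2R\<^sup>TR = R + R\<^sup>T\<close> yields both orthogonality and \<open>\<bar>R\<^sub>i\<^sub>j\<bar> \<le> 1\<close>, so that
  continuity of \<open>R\<close> at \<open>0\<close> follows from \<open>R = 1 + (t/2)WR\<close> without any formula for the inverse.\<close>

lemma stiefel_curve_exists:
  assumes Y: "Y \<in> stiefel p n" and xi: "\<xi> \<in> tangent p n Y"
  obtains \<gamma> where "stiefel_curve p n Y \<xi> \<gamma>"
proof -
  obtain W where W: "W \<in> carrier_mat n n" and skew: "W\<^sup>T = - W" and WY: "W * Y = \<xi>"
    using skew_tangent_generator[OF Y xi] .
  note [simp] = stiefelD(2-4)[OF Y]
  have [simp]: "dim_row W = n" "dim_col W = n" using W by auto
  have [simp]: "dim_row \<xi> = n" "dim_col \<xi> = p" using xi by (auto simp: tangent_def)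
  \<comment> \<open>The inverses are chosen independently for each \<open>t\<close>, so no
    regularity in \<open>t\<close> comes with them; it has to be derived from the defining
    equation.\<close>
  have "\<forall>t. \<exists>R. R \<in> carrier_mat n n \<and> (1\<^sub>m n - (t / 2) \<cdot>\<^sub>m W) * R = 1\<^sub>m n"
    using one_minus_skew_right_inverse[OF W skew] by blast
  from choice[OF this] obtain R where R: "\<And>t. R t \<in> carrier_mat n n"
      "\<And>t. (1\<^sub>m n - (t / 2) \<cdot>\<^sub>m W) * R t = 1\<^sub>m n"
    by auto
  have [simp]: "dim_row (R t) = n" "dim_col (R t) = n" for t using R(1)[of t] by auto
  have R_eq: "R t = 1\<^sub>m n + (t / 2) \<cdot>\<^sub>m (W * R t)" for t
  proof (rule eq_matI, goal_cases)
    case (1 i j)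
    have "R t - (t / 2) \<cdot>\<^sub>m (W * R t) = 1\<^sub>m n"
      using R(2)[of t] by (simp add: mat_laws)
    from arg_cong[OF this, of "\<lambda>M. M $$ (i, j)"] 1 show ?case
      by (simp del: index_mult_mat(1))
  qed auto
  \<comment> \<open>Inserting R = 1 + (t/2) W R into the right factor of R^T R gives R^T + (t/2) X
    with X = R^T W R. Inserting it into the left factor gives R - (t/2) X, since W is skew. Adding
    both cancels X.\<close>
  have RT_R: "2 \<cdot>\<^sub>m ((R t)\<^sup>T * R t) = R t + (R t)\<^sup>T" for t
  proof (rule eq_matI, goal_cases)
    case (1 i j)
    let ?X = "(R t)\<^sup>T * (W * R t)"
    have "(R t)\<^sup>T * R t = (R t)\<^sup>T * (1\<^sub>m n + (t / 2) \<cdot>\<^sub>m (W * R t))" by (simp flip: R_eq)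
    hence 2: "(R t)\<^sup>T * R t = (R t)\<^sup>T + (t / 2) \<cdot>\<^sub>m ?X" by (simp add: mat_laws)
    have "(R t)\<^sup>T * R t = (1\<^sub>m n + (t / 2) \<cdot>\<^sub>m (W * R t))\<^sup>T * R t" by (simp flip: R_eq)
    also have "\<dots> = R t + (t / 2) \<cdot>\<^sub>m ((R t)\<^sup>T * (- W * R t))"
      by (simp add: mat_laws skew)
    also have "- W * R t = - (W * R t)" by (rule eq_matI) (auto simp: scalar_prod_def sum_negf)
    also have "(R t)\<^sup>T * (- (W * R t)) = - ?X" 
      by (rule eq_matI) (auto simp: scalar_prod_def sum_negf)
    finally have 3: "(R t)\<^sup>T * R t = R t + (t / 2) \<cdot>\<^sub>m (- ?X)" .
    from arg_cong[OF 2, of "\<lambda>M. M $$ (i, j)"] arg_cong[OF 3, of "\<lambda>M. M $$ (i, j)"] 1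
    show ?case by (simp del: index_mult_mat(1))
  qed auto
  \<comment> \<open>On the diagonal the identity says that column j of R has squared norm R_jj. So
    R_jj^2 is at most R_jj, which forces R_jj to be at most 1, and this in turn bounds every entry
    of the column.\<close>
  have R_bound: "\<bar>R t $$ (i, j)\<bar> \<le> 1" if ij: "i < n" "j < n" for t i j
  proof -
    have col: "(\<Sum>k<n. (R t $$ (k, j))\<^sup>2) = R t $$ (j, j)"
      using arg_cong[OF RT_R[of t], of "\<lambda>M. M $$ (j, j)"] ij
      by (simp add: index_mult_sum power2_eq_square del: index_mult_mat(1))
    have le: "(R t $$ (k, j))\<^sup>2 \<le> R t $$ (j, j)" if "k < n" for k
      unfolding col[symmetric] using that by (intro member_le_sum) auto
    have "R t $$ (j, j) \<le> 1"
    proof (rule ccontr)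
      assume "\<not> R t $$ (j, j) \<le> 1"
      hence "R t $$ (j, j) * 1 < R t $$ (j, j) * R t $$ (j, j)"
        by (intro mult_strict_left_mono) auto
      with le[OF ij(2)] show False by (simp add: power2_eq_square)
    qed
    with le[OF ij(1)] have "(R t $$ (i, j))\<^sup>2 \<le> 1" by simp
    thus ?thesis by (simp add: abs_square_le_1)
  qed
  have R0: "R 0 = 1\<^sub>m n"
  proof (rule eq_matI, goal_cases)
    case (1 i j)
    thus ?case using arg_cong[OF R_eq[of 0], of "\<lambda>M. M $$ (i, j)"]
      by (simp del: index_mult_mat(1))
  qed auto
  have R_cont: "isCont (\<lambda>t. R t $$ (i, j)) 0" if ij: "i < n" "j < n" for i j
  proof -
    define c where "c = (\<Sum>k<n. \<bar>W $$ (i, k)\<bar>)"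
    have bound: "norm (R t $$ (i, j) - 1\<^sub>m n $$ (i, j)) \<le> \<bar>t\<bar> * c" for t
    proof -
      have eq: "R t $$ (i, j) - 1\<^sub>m n $$ (i, j) = (t / 2) * (\<Sum>k<n. W $$ (i, k) * R t $$ (k, j))"
        using ij arg_cong[OF R_eq[of t], of "\<lambda>M. M $$ (i, j)"]
        by (simp add: index_mult_sum del: index_mult_mat(1))
      moreover have "\<bar>\<Sum>k<n. W $$ (i, k) * R t $$ (k, j)\<bar> \<le> c"
        unfolding c_def using R_bound ij
        by (intro order.trans[OF sum_abs] sum_mono) (auto simp: abs_mult intro: mult_left_le)
      ultimately show ?thesis
        unfolding eq real_norm_def abs_mult by (intro mult_mono) auto
    qed
    have "((\<lambda>t. R t $$ (i, j) - 1\<^sub>m n $$ (i, j)) \<longlongrightarrow> 0) (at 0)"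
      by (rule tendsto_0_le[OF tendsto_ident_at, where K = c]) (use bound in auto)
    thus ?thesis by (simp add: isCont_def R0 LIM_zero_iff)
  qed
  \<comment> \<open>Equal to (2R - 1) Y because (t/2) W R = R - 1. This form shows the increment as
    t times a function continuous at 0; the form 2 R Y - Y serves for orthogonality.\<close>
  define \<gamma> where "\<gamma> t = Y + t \<cdot>\<^sub>m (W * (R t * Y))" for t
  have [simp]: "dim_row (\<gamma> t) = n" "dim_col (\<gamma> t) = p" for t by (simp_all add: \<gamma>_def)
  have \<gamma>_R: "\<gamma> t = 2 \<cdot>\<^sub>m (R t * Y) - Y" for t
  proof (rule eq_matI, goal_cases)
    case (1 i j)
    have "R t * Y = (1\<^sub>m n + (t / 2) \<cdot>\<^sub>m (W * R t)) * Y" by (simp flip: R_eq)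
    also have "\<dots> = Y + (t / 2) \<cdot>\<^sub>m (W * (R t * Y))" by (simp add: mat_laws)
    finally have eq: "R t * Y = Y + (t / 2) \<cdot>\<^sub>m (W * (R t * Y))" .
    show ?case using arg_cong[OF eq, of "\<lambda>M. M $$ (i, j)"] 1
      by (simp add: \<gamma>_def del: index_mult_mat(1))
  qed auto
  \<comment> \<open>Expanding (2 R Y - Y)^T (2 R Y - Y) leaves Y^T Y plus twice Y^T (2 R^T R - R -
    R^T) Y, and the bracket is zero.\<close>
  have "(\<gamma> t)\<^sup>T * \<gamma> t = 1\<^sub>m p" for t
  proof -
    have "Y\<^sup>T * ((2 \<cdot>\<^sub>m ((R t)\<^sup>T * R t)) * Y) = Y\<^sup>T * ((R t + (R t)\<^sup>T) * Y)"
      by (simp only: RT_R)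
    hence "2 \<cdot>\<^sub>m (Y\<^sup>T * ((R t)\<^sup>T * (R t * Y))) = Y\<^sup>T * (R t * Y) + Y\<^sup>T * ((R t)\<^sup>T * Y)"
      by (simp add: mat_laws)
    note * = arg_cong[OF this, of "\<lambda>M. M $$ (i, j)" for i j]
    show ?thesis
    proof (rule eq_matI, goal_cases)
      case (1 i j)
      with *[of i j] show ?case
        by (simp add: \<gamma>_R mat_laws del: index_mult_mat(1))
    qed auto
  qed
  hence "\<gamma> t \<in> stiefel p n" for t by (auto simp: stiefel_def)
  moreover have "\<gamma> 0 = Y" by (auto simp: \<gamma>_def mat_eq_iff simp del: index_mult_mat(1))
  \<comment> \<open>Caratheodory's criterion with the entry of W R(z) Y as slope function: it is
    continuous at 0, and its value there is the entry of \<xi> because R(0) = 1 and W Y =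
    \<xi>.\<close>
  moreover have "has_mat_derivative n p \<gamma> \<xi> 0"
    unfolding has_mat_derivative_def
  proof (intro conjI allI impI)
    fix i j assume ij: "i < n" "j < p"
    have "\<gamma> z $$ (i, j) - \<gamma> 0 $$ (i, j) = (W * (R z * Y)) $$ (i, j) * (z - 0)" for z
      using ij by (simp add: \<gamma>_def del: index_mult_mat(1))
    moreover have "isCont (\<lambda>z. (W * (R z * Y)) $$ (i, j)) 0"
      using ij R_cont by (auto simp: index_mult_sum simp del: index_mult_mat(1)
        intro!: continuous_intros)
    moreover have "(W * (R 0 * Y)) $$ (i, j) = \<xi> $$ (i, j)"
      by (simp add: R0 mat_laws WY del: index_mult_mat(1))
    ultimately show "((\<lambda>s. \<gamma> s $$ (i, j)) has_real_derivative \<xi> $$ (i, j)) (at 0)"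
      unfolding CARAT_DERIV by (intro exI[of _ "\<lambda>z. (W * (R z * Y)) $$ (i, j)"]) blast
  qed (auto)
  ultimately show ?thesis using that[of \<gamma>] by (simp add: stiefel_curve_def)
qed

section \<open>Riemannian gradient and Hessian\<close>

lemma mtrace_mult_commute:
  assumes "dim_col P = dim_row Q" "dim_col Q = dim_row P"
  shows "mtrace (P * Q) = mtrace (Q * P)"
proof -
  have "mtrace (P * Q) = (\<Sum>i<dim_row P. \<Sum>k<dim_row Q. P $$ (i, k) * Q $$ (k, i))"
    using assms by (auto simp: mtrace_def index_mult_sum simp del: index_mult_mat(1) intro!: sum.cong)
  also have "\<dots> = (\<Sum>k<dim_row Q. \<Sum>i<dim_row P. Q $$ (k, i) * P $$ (i, k))"
    by (subst sum.swap) (simp only: mult.commute)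
  also have "\<dots> = mtrace (Q * P)"
    using assms by (auto simp: mtrace_def index_mult_sum simp del: index_mult_mat(1) intro!: sum.cong)
  finally show ?thesis .
qed

lemma mtrace_transpose: "dim_row W = dim_col W \<Longrightarrow> mtrace (W\<^sup>T) = mtrace W"
  by (simp add: mtrace_def)

lemma mtrace_add: "dim_row P = dim_row Q \<Longrightarrow> dim_col P = dim_row Q \<Longrightarrow> dim_col Q = dim_row Q \<Longrightarrow>
    mtrace (P + Q) = mtrace P + mtrace Q"
  by (simp add: mtrace_def sum.distrib)

lemma mtrace_minus: "dim_row P = dim_row Q \<Longrightarrow> dim_col P = dim_row Q \<Longrightarrow> dim_col Q = dim_row Q \<Longrightarrow>
    mtrace (P - Q) = mtrace P - mtrace Q"
  by (simp add: mtrace_def sum_subtractf)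

lemma mtrace_diag_part_mult:
  "dim_row Z = dim_row X \<Longrightarrow> dim_col X = dim_row X \<Longrightarrow>
    mtrace (diag_part Z * X) = (\<Sum>i<dim_row X. Z $$ (i, i) * X $$ (i, i))"
  by (auto simp: mtrace_def index_mult_sum diag_part_index if_distrib[of "\<lambda>x. x * _"]
      simp del: index_mult_mat(1) cong: if_cong intro!: sum.cong)

lemma metric_entries:
  "dim_row W = dim_row \<xi> \<Longrightarrow> dim_col W = dim_col \<xi> \<Longrightarrow>
    metric W \<xi> = (\<Sum>j<dim_col \<xi>. \<Sum>i<dim_row \<xi>. W $$ (i, j) * \<xi> $$ (i, j))"
  by (simp add: metric_def mtrace_def index_mult_sum del: index_mult_mat(1))

lemma metric_minus:
  "dim_row V = dim_row \<xi> \<Longrightarrow> dim_col V = dim_col \<xi> \<Longrightarrow>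
    dim_row W = dim_row \<xi> \<Longrightarrow> dim_col W = dim_col \<xi> \<Longrightarrow>
    metric (V - W) \<xi> = metric V \<xi> - metric W \<xi>"
  by (simp add: metric_entries sum_subtractf left_diff_distrib)

lemma metric_smult_msum:
  assumes "\<xi> \<in> carrier_mat r c" "\<And>l. l \<in> S \<Longrightarrow> F l \<in> carrier_mat r c"
  shows "metric (a \<cdot>\<^sub>m msum r c F S) \<xi> = a * (\<Sum>l\<in>S. metric (F l) \<xi>)"
proof -
  have "(\<Sum>l\<in>S. metric (F l) \<xi>) = (\<Sum>l\<in>S. \<Sum>j<c. \<Sum>i<r. F l $$ (i, j) * \<xi> $$ (i, j))"
    using assms by (intro sum.cong refl, subst metric_entries) force+
  also have "\<dots> = (\<Sum>j<c. \<Sum>l\<in>S. \<Sum>i<r. F l $$ (i, j) * \<xi> $$ (i, j))"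
    by (rule sum.swap)
  also have "\<dots> = (\<Sum>j<c. \<Sum>i<r. \<Sum>l\<in>S. F l $$ (i, j) * \<xi> $$ (i, j))"
    by (intro sum.cong refl sum.swap)
  finally show ?thesis
    using assms(1) by (auto simp: metric_entries msum_index sum_distrib_right sum_distrib_left mult.assoc
      intro!: sum.cong)
qed

text \<open>A vanishing sum of squares. This definiteness serves twice: to identify two candidates
  for the gradient, and to show that the frame is complete.\<close>

lemma metric_self_eq_zero:
  assumes "\<xi> \<in> carrier_mat r c" "metric \<xi> \<xi> = 0"
  shows "\<xi> = 0\<^sub>m r c"
proof (rule eq_matI, goal_cases)
  case (1 i j)
  have "\<forall>j<c. (\<Sum>i<r. \<xi> $$ (i, j) * \<xi> $$ (i, j)) = 0"
    using assms by (subst (asm) metric_entries, simp, simp, subst (asm) sum_nonneg_eq_0_iff)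
      (auto intro: sum_nonneg)
  hence "(\<Sum>i<r. \<xi> $$ (i, j) * \<xi> $$ (i, j)) = 0" using 1 by auto
  hence "\<forall>i<r. \<xi> $$ (i, j) * \<xi> $$ (i, j) = 0"
    by (subst (asm) sum_nonneg_eq_0_iff) auto
  thus ?case using 1 by auto
qed (use assms in auto)

lemma proj_carrier: "Y \<in> carrier_mat n p \<Longrightarrow> W \<in> carrier_mat n p \<Longrightarrow> proj Y W \<in> carrier_mat n p"
  by (auto simp: proj_def)

text \<open>Since Y^T Y = 1, the projection removes exactly the symmetric part of Y^T W. The 1/2 of
  the remaining skew part is the one that meets the factor -4 in the upper blocks.\<close>

lemma transpose_mult_proj:
  assumes Y: "Y \<in> stiefel p n" and W: "W \<in> carrier_mat n p"
  shows "Y\<^sup>T * proj Y W = (1/2) \<cdot>\<^sub>m (Y\<^sup>T * W - (Y\<^sup>T * W)\<^sup>T)"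
proof -
  note [simp] = stiefelD(2-4)[OF Y]
  have [simp]: "dim_row W = n" "dim_col W = p" using W by auto
  have "Y\<^sup>T * (Y * sym_part (Y\<^sup>T * W)) = (Y\<^sup>T * Y) * sym_part (Y\<^sup>T * W)"
    by (subst mult_assoc_dim) auto
  hence *: "Y\<^sup>T * proj Y W = Y\<^sup>T * W - sym_part (Y\<^sup>T * W)"
    by (simp add: proj_def mat_laws)
  show ?thesis unfolding *
  proof (rule eq_matI, goal_cases)
    case (1 i j)
    thus ?case by (simp add: sym_part_index field_simps del: index_mult_mat(1))
  qed auto
qed

lemma proj_tangent:
  assumes Y: "Y \<in> stiefel p n" and W: "W \<in> carrier_mat n p"
  shows "proj Y W \<in> tangent p n Y"
proof -
  note [simp] = stiefelD(2-3)[OF Y]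
  have c: "proj Y W \<in> carrier_mat n p" using proj_carrier[OF stiefelD(1)[OF Y] W] .
  hence [simp]: "dim_row (proj Y W) = n" "dim_col (proj Y W) = p" by auto
  have "(proj Y W)\<^sup>T * Y + Y\<^sup>T * proj Y W = (Y\<^sup>T * proj Y W)\<^sup>T + Y\<^sup>T * proj Y W"
    by (simp add: mat_laws)
  also have "\<dots> = 0\<^sub>m p p"
    unfolding transpose_mult_proj[OF assms] using W
    by (intro eq_matI) (auto simp: field_simps simp del: index_mult_mat(1))
  finally show ?thesis using c by (simp add: tangent_def)
qed

text \<open>The removed part Y S, with S symmetric, is normal: its pairing with \<xi> is tr(S K) for
  the skew matrix K = Y^T \<xi>, and transposition gives tr(S K) = tr(S K^T) = -tr(S K).\<close>

lemma metric_proj: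
  assumes Y: "Y \<in> stiefel p n" and W: "W \<in> carrier_mat n p" and xi: "\<xi> \<in> tangent p n Y"
  shows "metric (proj Y W) \<xi> = metric W \<xi>"
proof -
  note [simp] = stiefelD(2-4)[OF Y]
  have [simp]: "dim_row W = n" "dim_col W = p" using W by auto
  have [simp]: "dim_row \<xi> = n" "dim_col \<xi> = p" and tan: "\<xi>\<^sup>T * Y + Y\<^sup>T * \<xi> = 0\<^sub>m p p"
    using xi by (auto simp: tangent_def)
  define S where "S = sym_part (Y\<^sup>T * W)"
  have [simp]: "dim_row S = p" "dim_col S = p" "S\<^sup>T = S"
    by (auto simp: S_def intro!: sym_part_transpose)
  define K where "K = Y\<^sup>T * \<xi>"
  have [simp]: "dim_row K = p" "dim_col K = p" by (auto simp: K_def)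
  have skew: "K\<^sup>T + K = 0\<^sub>m p p" using tan by (simp add: K_def mat_laws)
  have "mtrace (S * K) = mtrace ((S * K)\<^sup>T)" by (simp add: mtrace_transpose)
  also have "\<dots> = mtrace (S * K\<^sup>T)"
    by (simp add: mat_laws mtrace_mult_commute)
  finally have "2 * mtrace (S * K) = mtrace (S * (K\<^sup>T + K))"
    by (simp add: mat_laws mtrace_add)
  hence "mtrace (S * K) = 0" by (simp add: skew mtrace_def)
  moreover have "metric (proj Y W) \<xi> = metric W \<xi> - mtrace (S * K)"
    by (simp add: metric_def proj_def mat_laws mtrace_minus K_def flip: S_def)
  ultimately show ?thesis by simp
qed

section \<open>The cost and its derivatives\<close>

lemma frob_norm_diag_part_square:
  assumes "dim_row Z = p"
  shows "(frob_norm (diag_part Z))\<^sup>2 = (\<Sum>i<p. (Z $$ (i, i))\<^sup>2)"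
proof -
  have "(frob_norm (diag_part Z))\<^sup>2 = (\<Sum>i<p. \<Sum>j<p. (diag_part Z $$ (i, j))\<^sup>2)"
    using assms by (simp add: frob_norm_def sum_nonneg)
  also have "\<dots> = (\<Sum>i<p. \<Sum>j<p. if i = j then (Z $$ (i, i))\<^sup>2 else 0)"
    using assms by (intro sum.cong refl) (auto simp: diag_part_index)
  finally show ?thesis by simp
qed

text \<open>For symmetric \<open>A l\<close>, the gradient of the extension of the cost to all
  matrices of format n x p.\<close>

definition euclidean_grad :: "nat \<Rightarrow> nat \<Rightarrow> nat \<Rightarrow> (nat \<Rightarrow> real mat) \<Rightarrow> real mat \<Rightarrow> real mat" where
  "euclidean_grad p n N A Y =
     (-4) \<cdot>\<^sub>m msum n p (\<lambda>l. A l * Y * diag_part (Y\<^sup>T * A l * Y)) {1..N}"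

text \<open>For symmetric \<open>A l\<close>, the directional derivative of
  \<open>euclidean_grad\<close> along \<xi>. The 2 stems from the two outer factors of Y^T A Y
  inside \<open>diag_part\<close>, which contribute equally.\<close>

definition euclidean_hess ::
    "nat \<Rightarrow> nat \<Rightarrow> nat \<Rightarrow> (nat \<Rightarrow> real mat) \<Rightarrow> real mat \<Rightarrow> real mat \<Rightarrow> real mat" where
  "euclidean_hess p n N A Y \<xi> =
     (-4) \<cdot>\<^sub>m msum n p (\<lambda>l. A l * \<xi> * diag_part (Y\<^sup>T * A l * Y)
       + 2 \<cdot>\<^sub>m (A l * Y * diag_part (Y\<^sup>T * A l * \<xi>))) {1..N}"

lemma euclidean_grad_dim [simp]:
  "dim_row (euclidean_grad p n N A Y) = n" "dim_col (euclidean_grad p n N A Y) = p"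
  by (simp_all add: euclidean_grad_def)

lemma euclidean_hess_dim [simp]:
  "dim_row (euclidean_hess p n N A Y \<xi>) = n" "dim_col (euclidean_hess p n N A Y \<xi>) = p"
  by (simp_all add: euclidean_hess_def)

text \<open>The two summands are transposes of each other and so share their diagonal.\<close>

lemma diag_part_symmetric_derivative:
  assumes "A \<in> carrier_mat n n" "A\<^sup>T = A" "Y \<in> carrier_mat n p" "\<xi> \<in> carrier_mat n p"
  shows "diag_part (\<xi>\<^sup>T * A * Y + Y\<^sup>T * A * \<xi>) = 2 \<cdot>\<^sub>m diag_part (Y\<^sup>T * A * \<xi>)"
proof (rule eq_matI, goal_cases)
  case (1 i j)
  have [simp]: "dim_row A = n" "dim_col A = n" "dim_row Y = n" "dim_col Y = p" 
    "dim_row \<xi> = n" "dim_col \<xi> = p" using assms by auto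
  have "\<xi>\<^sup>T * A * Y = (Y\<^sup>T * A * \<xi>)\<^sup>T" by (simp add: mat_laws assms)
  thus ?case using 1 by (simp add: diag_part_index del: index_mult_mat(1))
qed auto

locale symmetric_family =
  fixes n N :: nat and A :: "nat \<Rightarrow> real mat"
  assumes A_carrier: "\<And>l. l \<in> {1..N} \<Longrightarrow> A l \<in> carrier_mat n n"
    and A_sym: "\<And>l. l \<in> {1..N} \<Longrightarrow> (A l)\<^sup>T = A l"
begin

lemma A_dim: "l \<in> {1..N} \<Longrightarrow> dim_row (A l) = n" "l \<in> {1..N} \<Longrightarrow> dim_col (A l) = n"
  using A_carrier by auto

lemma has_mat_derivative_quadratic:
  assumes l: "l \<in> {1..N}" and \<gamma>: "stiefel_curve p n Y \<xi> \<gamma>"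
  shows "has_mat_derivative p p (\<lambda>t. (\<gamma> t)\<^sup>T * A l * \<gamma> t) (\<xi>\<^sup>T * A l * Y + Y\<^sup>T * A l * \<xi>) 0"
proof -
  note \<gamma>D = stiefel_curveD[OF \<gamma>]
  note [simp] = \<gamma>D(3-5) A_dim[OF l]
  have \<xi>: "\<xi> \<in> carrier_mat n p" using has_mat_derivativeD(2)[OF \<gamma>D(6)] .
  have [simp]: "dim_row Y = n" "dim_col Y = p" using \<gamma>D(3,4)[of 0] by simp_all
  have "has_mat_derivative p n (\<lambda>t. (\<gamma> t)\<^sup>T * A l) (\<xi>\<^sup>T * A l + (\<gamma> 0)\<^sup>T * 0\<^sub>m n n) 0"
    by (rule has_mat_derivative_mult[where k = n])
      (use \<gamma>D \<xi> A_carrier[OF l] in \<open>auto intro!: has_mat_derivative_transpose[of \<gamma> n p]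
         has_mat_derivative_const\<close>)
  also have "\<xi>\<^sup>T * A l + (\<gamma> 0)\<^sup>T * 0\<^sub>m n n = \<xi>\<^sup>T * A l"
    using \<xi> by (intro eq_matI) auto
  finally have "has_mat_derivative p p (\<lambda>t. (\<gamma> t)\<^sup>T * A l * \<gamma> t)
      (\<xi>\<^sup>T * A l * \<gamma> 0 + (\<gamma> 0)\<^sup>T * A l * \<xi>) 0"
    by (intro has_mat_derivative_mult[where k = n] \<gamma>D) (auto intro!: carrier_matI)
  thus ?thesis by simp
qed

text \<open>A diagonal entry z of Y^T A Y has derivative 2x, with x the same entry of Y^T A \<xi>,
  so -z^2 contributes -4zx. On the other side (A Y D)^T \<xi> = D Y^T A \<xi> with D diagonal, whose
  trace is the sum of these zx.\<close>

lemma jd_cost_has_derivative: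
  assumes Y: "Y \<in> stiefel p n" and \<gamma>: "stiefel_curve p n Y \<xi> \<gamma>"
  shows "((\<lambda>t. jd_cost N A (\<gamma> t)) has_real_derivative metric (euclidean_grad p n N A Y) \<xi>) (at 0)"
proof -
  note \<gamma>D = stiefel_curveD[OF \<gamma>]
  note [simp] = \<gamma>D(3-5) stiefelD(2,3)[OF Y]
  have \<xi>: "\<xi> \<in> carrier_mat n p" using has_mat_derivativeD(2)[OF \<gamma>D(6)] .
  hence [simp]: "dim_row \<xi> = n" "dim_col \<xi> = p" by auto
  let ?Z = "\<lambda>l t. (\<gamma> t)\<^sup>T * A l * \<gamma> t"
  let ?X = "\<lambda>l. Y\<^sup>T * A l * \<xi>"
  have entry: "((\<lambda>t. ?Z l t $$ (i, i)) has_real_derivative 2 * ?X l $$ (i, i)) (at 0)"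
    if l: "l \<in> {1..N}" and i: "i < p" for l i
  proof -
    have "diag_part (\<xi>\<^sup>T * A l * Y + Y\<^sup>T * A l * \<xi>) = 2 \<cdot>\<^sub>m diag_part (?X l)"
      by (rule diag_part_symmetric_derivative)
        (use A_carrier[OF l] A_sym[OF l] stiefelD(1)[OF Y] \<xi> in auto)
    from arg_cong[OF this, of "\<lambda>M. M $$ (i, i)"]
    have "(\<xi>\<^sup>T * A l * Y + Y\<^sup>T * A l * \<xi>) $$ (i, i) = 2 * ?X l $$ (i, i)"
      using i by (simp add: diag_part_index del: index_mult_mat(1))
    with has_mat_derivativeD(1)[OF has_mat_derivative_quadratic[OF l \<gamma>] i i] show ?thesis by simp
  qed
  have "metric (euclidean_grad p n N A Y) \<xi> =
      (-4) * (\<Sum>l\<in>{1..N}. metric (A l * Y * diag_part (Y\<^sup>T * A l * Y)) \<xi>)"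
    unfolding euclidean_grad_def
    by (rule metric_smult_msum[OF \<xi>]) (auto simp: A_dim intro!: carrier_matI)
  also have "(\<Sum>l\<in>{1..N}. metric (A l * Y * diag_part (Y\<^sup>T * A l * Y)) \<xi>) =
      (\<Sum>l\<in>{1..N}. \<Sum>i<p. ?Z l 0 $$ (i, i) * ?X l $$ (i, i))"
  proof (rule sum.cong[OF refl])
    fix l assume l: "l \<in> {1..N}"
    note [simp] = A_dim[OF l]
    have "(A l * Y * diag_part (Y\<^sup>T * A l * Y))\<^sup>T * \<xi> = diag_part (Y\<^sup>T * A l * Y) * ?X l"
      by (simp add: mat_laws A_sym[OF l])
    thus "metric (A l * Y * diag_part (Y\<^sup>T * A l * Y)) \<xi> =
        (\<Sum>i<p. ?Z l 0 $$ (i, i) * ?X l $$ (i, i))"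
      by (simp add: metric_def mtrace_diag_part_mult del: index_mult_mat(1))
  qed
  \<comment> \<open>The right-hand side is written in the shape that \<open>DERIV_power\<close>
    produces for exponent 2, so that the derivative rules below unify directly.\<close>
  finally have m: "metric (euclidean_grad p n N A Y) \<xi> =
      - (\<Sum>l\<in>{1..N}. \<Sum>i<p. of_nat 2 * (2 * ?X l $$ (i, i) * ?Z l 0 $$ (i, i) ^ (2 - Suc 0)))"
    by (simp add: sum_distrib_left mult_ac sum_negf del: index_mult_mat(1))
  have f: "jd_cost N A (\<gamma> t) = - (\<Sum>l\<in>{1..N}. \<Sum>i<p. (?Z l t $$ (i, i))\<^sup>2)" for t
    by (simp add: jd_cost_def frob_norm_diag_part_square)
  show ?thesis
    unfolding m f
    by (intro DERIV_minus DERIV_sum DERIV_power entry) auto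
qed

text \<open>Existence is \<open>metric_proj\<close>. For uniqueness the difference d of two
  candidates is tangent, so some curve has velocity d; along it both candidates give the derivative
  of the cost, whence \<open>metric d d = 0\<close>.\<close>

lemma rgrad_eq:
  assumes Y: "Y \<in> stiefel p n"
  shows "rgrad p n (jd_cost N A) Y = proj Y (euclidean_grad p n N A Y)"
  unfolding rgrad_def
proof (rule the_equality)
  let ?E = "euclidean_grad p n N A Y"
  have E: "?E \<in> carrier_mat n p" by (auto intro!: carrier_matI)
  show gr: "proj Y ?E \<in> tangent p n Y \<and> (\<forall>\<xi>\<in>tangent p n Y. \<forall>\<gamma>. stiefel_curve p n Y \<xi> \<gamma> \<longrightarrow>
      ((\<lambda>t. jd_cost N A (\<gamma> t)) has_real_derivative metric (proj Y ?E) \<xi>) (at 0))"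
    using proj_tangent[OF Y E] metric_proj[OF Y E] jd_cost_has_derivative[OF Y] by auto
  fix g
  assume g: "g \<in> tangent p n Y \<and> (\<forall>\<xi>\<in>tangent p n Y. \<forall>\<gamma>. stiefel_curve p n Y \<xi> \<gamma> \<longrightarrow>
      ((\<lambda>t. jd_cost N A (\<gamma> t)) has_real_derivative metric g \<xi>) (at 0))"
  note [simp] = stiefelD(2,3)[OF Y]
  define d where "d = g - proj Y ?E"
  have carr: "g \<in> carrier_mat n p" "proj Y ?E \<in> carrier_mat n p"
    using g gr by (auto simp: tangent_def)
  hence [simp]: "dim_row g = n" "dim_col g = p" "dim_row (proj Y ?E) = n" "dim_col (proj Y ?E) = p"
    by auto
  have d: "d \<in> tangent p n Y"
  proof -
    have t: "g\<^sup>T * Y + Y\<^sup>T * g = 0\<^sub>m p p" "(proj Y ?E)\<^sup>T * Y + Y\<^sup>T * proj Y ?E = 0\<^sub>m p p"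
      using g gr by (auto simp: tangent_def)
    have "d\<^sup>T * Y + Y\<^sup>T * d = (g\<^sup>T * Y + Y\<^sup>T * g) - ((proj Y ?E)\<^sup>T * Y + Y\<^sup>T * proj Y ?E)"
      unfolding d_def by (simp add: mat_laws) (intro eq_matI, auto simp del: index_mult_mat(1))
    thus ?thesis unfolding t by (auto simp: tangent_def d_def intro!: carrier_matI)
  qed
  obtain \<gamma> where "stiefel_curve p n Y d \<gamma>" using stiefel_curve_exists[OF Y d] .
  with g gr d have "metric g d = metric (proj Y ?E) d" by (meson DERIV_unique)
  moreover have "metric d d = metric g d - metric (proj Y ?E) d"
    unfolding d_def by (rule metric_minus) simp_all
  ultimately have "metric d d = 0" by simp
  moreover have "d \<in> carrier_mat n p" using d by (simp add: tangent_def)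
  ultimately have "d = 0\<^sub>m n p" by (metis metric_self_eq_zero)
  hence "d $$ (i, j) = 0" if "i < n" "j < p" for i j using that by simp
  hence "g $$ (i, j) = proj Y ?E $$ (i, j)" if "i < n" "j < p" for i j
    using that by (fastforce simp: d_def)
  thus "g = proj Y ?E" by (intro eq_matI) simp_all
qed

end

text \<open>Y^T Y S = S is already symmetric, so \<open>sym_part\<close> reproduces it and the two
  occurrences of Y S cancel. This discards the derivative of the normal correction from the
  Hessian.\<close>

lemma proj_minus_symmetric:
  assumes Y: "Y \<in> stiefel p n" and W: "W \<in> carrier_mat n p"
    and S: "S \<in> carrier_mat p p" "S\<^sup>T = S"
  shows "proj Y (W - Y * S) = proj Y W"
proof -
  note [simp] = stiefelD(2-4)[OF Y]
  have [simp]: "dim_row W = n" "dim_col W = p" "dim_row S = p" "dim_col S = p" using W S by auto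
  have "Y\<^sup>T * (Y * S) = (Y\<^sup>T * Y) * S" by (subst mult_assoc_dim) auto
  hence YYS: "Y\<^sup>T * (Y * S) = S" by (simp add: left_one_dim)
  have "S $$ (j, i) = S $$ (i, j)" if "i < p" "j < p" for i j
    using arg_cong[OF S(2), of "\<lambda>M. M $$ (i, j)"] that by simp
  hence "sym_part (Y\<^sup>T * W - S) = sym_part (Y\<^sup>T * W) - S"
    by (intro eq_matI) (auto simp: sym_part_index field_simps simp del: index_mult_mat(1))
  thus ?thesis
    by (simp add: proj_def mult_minus_dim YYS) (intro eq_matI, auto simp del: index_mult_mat(1))
qed

context symmetric_family
begin

lemma has_mat_derivative_euclidean_grad:
  assumes \<gamma>: "stiefel_curve p n Y \<xi> \<gamma>"
  shows "has_mat_derivative n p (\<lambda>t. euclidean_grad p n N A (\<gamma> t)) (euclidean_hess p n N A Y \<xi>) 0"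
  unfolding euclidean_grad_def euclidean_hess_def
proof (intro has_mat_derivative_smult has_mat_derivative_msum)
  note \<gamma>D = stiefel_curveD[OF \<gamma>]
  note [simp] = \<gamma>D(3-5)
  have \<xi>: "\<xi> \<in> carrier_mat n p" using has_mat_derivativeD(2)[OF \<gamma>D(6)] .
  have Y: "Y \<in> carrier_mat n p" using \<gamma>D(2)[of 0] by simp
  fix l assume l: "l \<in> {1..N}"
  note [simp] = A_dim[OF l]
  have "has_mat_derivative n p (\<lambda>t. A l * \<gamma> t) (0\<^sub>m n n * \<gamma> 0 + A l * \<xi>) 0"
    by (rule has_mat_derivative_mult[where k = n])
      (use \<gamma>D A_carrier[OF l] in \<open>auto intro!: has_mat_derivative_const\<close>)
  also have "0\<^sub>m n n * \<gamma> 0 + A l * \<xi> = A l * \<xi>"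
    using \<xi> Y by (intro eq_matI) auto
  finally have "has_mat_derivative n p (\<lambda>t. A l * \<gamma> t * diag_part ((\<gamma> t)\<^sup>T * A l * \<gamma> t))
      (A l * \<xi> * diag_part ((\<gamma> 0)\<^sup>T * A l * \<gamma> 0)
        + A l * \<gamma> 0 * diag_part (\<xi>\<^sup>T * A l * Y + Y\<^sup>T * A l * \<xi>)) 0"
    by (intro has_mat_derivative_mult[where k = p] has_mat_derivative_diag_part
        has_mat_derivative_quadratic[OF l \<gamma>]) (auto intro!: carrier_matI)
  thus "has_mat_derivative n p (\<lambda>t. A l * \<gamma> t * diag_part ((\<gamma> t)\<^sup>T * A l * \<gamma> t))
      (A l * \<xi> * diag_part (Y\<^sup>T * A l * Y) + 2 \<cdot>\<^sub>m (A l * Y * diag_part (Y\<^sup>T * A l * \<xi>))) 0"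
    unfolding diag_part_symmetric_derivative[OF A_carrier[OF l] A_sym[OF l] Y \<xi>] \<gamma>D(5)
    using Y \<xi> by (subst (asm) mult_smult_dim) auto
qed auto

text \<open>The product rule for E - Y sym(Y^T E). The last summand is left unsimplified: it is Y
  times a symmetric matrix, which the projection kills.\<close>

lemma has_mat_derivative_proj_grad:
  assumes Y: "Y \<in> stiefel p n" and \<gamma>: "stiefel_curve p n Y \<xi> \<gamma>"
  defines "E \<equiv> euclidean_grad p n N A Y" and "H \<equiv> euclidean_hess p n N A Y \<xi>"
  shows "has_mat_derivative n p (\<lambda>t. proj (\<gamma> t) (euclidean_grad p n N A (\<gamma> t)))
    (H - (\<xi> * sym_part (Y\<^sup>T * E) + Y * sym_part (\<xi>\<^sup>T * E + Y\<^sup>T * H))) 0"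
proof -
  note \<gamma>D = stiefel_curveD[OF \<gamma>]
  note [simp] = \<gamma>D(3-5)
  let ?E = "\<lambda>t. euclidean_grad p n N A (\<gamma> t)"
  have dE: "has_mat_derivative n p ?E H 0"
    unfolding H_def by (rule has_mat_derivative_euclidean_grad[OF \<gamma>])
  have "has_mat_derivative p p (\<lambda>t. (\<gamma> t)\<^sup>T * ?E t) (\<xi>\<^sup>T * ?E 0 + (\<gamma> 0)\<^sup>T * H) 0"
    by (rule has_mat_derivative_mult[where k = n])
      (use dE \<gamma>D in \<open>auto intro!: has_mat_derivative_transpose[of \<gamma> n p] carrier_matI\<close>)
  hence "has_mat_derivative p p (\<lambda>t. sym_part ((\<gamma> t)\<^sup>T * ?E t))
      (sym_part (\<xi>\<^sup>T * ?E 0 + (\<gamma> 0)\<^sup>T * H)) 0"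
    by (rule has_mat_derivative_sym_part[rotated]) (auto intro!: carrier_matI)
  hence "has_mat_derivative n p (\<lambda>t. \<gamma> t * sym_part ((\<gamma> t)\<^sup>T * ?E t))
      (\<xi> * sym_part ((\<gamma> 0)\<^sup>T * ?E 0) + \<gamma> 0 * sym_part (\<xi>\<^sup>T * ?E 0 + (\<gamma> 0)\<^sup>T * H)) 0"
    by (rule has_mat_derivative_mult[OF \<gamma>D(2) _ \<gamma>D(6), rotated]) (auto intro!: carrier_matI)
  with dE show ?thesis
    unfolding proj_def E_def
    by (intro has_mat_derivative_minus) (auto intro!: carrier_matI)
qed

lemma rhess_eq:
  assumes Y: "Y \<in> stiefel p n" and \<xi>: "\<xi> \<in> tangent p n Y"
  shows "rhess p n (jd_cost N A) Y \<xi> = proj Y (euclidean_hess p n N A Y \<xi>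
    - \<xi> * sym_part (Y\<^sup>T * euclidean_grad p n N A Y))"
proof -
  note [simp] = stiefelD(2,3)[OF Y]
  have [simp]: "dim_row \<xi> = n" "dim_col \<xi> = p" using \<xi> by (auto simp: tangent_def)
  let ?E = "euclidean_grad p n N A Y" and ?H = "euclidean_hess p n N A Y \<xi>"
  let ?S = "sym_part (Y\<^sup>T * ?E)" and ?S' = "sym_part (\<xi>\<^sup>T * ?E + Y\<^sup>T * ?H)"
  let ?V = "?H - (\<xi> * ?S + Y * ?S')"
  let ?P = "\<lambda>\<gamma> V. has_mat_derivative n p (\<lambda>t. rgrad p n (jd_cost N A) (\<gamma> t)) V 0"
  \<comment> \<open>The curve never leaves the manifold, so \<open>rgrad_eq\<close> applies at every
    \<open>\<gamma> t\<close> and turns the gradient field into an explicit formula. The derivative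
    obtained is the same for all curves with velocity \<xi>.\<close>
  have V: "?P \<gamma> ?V" if "stiefel_curve p n Y \<xi> \<gamma>" for \<gamma>
    using has_mat_derivative_proj_grad[OF Y that] stiefel_curveD(1)[OF that] by (simp add: rgrad_eq)
  have "?V = (?H - \<xi> * ?S) - Y * ?S'"
    by (intro eq_matI) (auto simp del: index_mult_mat(1))
  moreover have "proj Y ((?H - \<xi> * ?S) - Y * ?S') = proj Y (?H - \<xi> * ?S)"
    by (rule proj_minus_symmetric[OF Y]) (auto intro!: carrier_matI sym_part_transpose)
  ultimately have eq: "proj Y ?V = proj Y (?H - \<xi> * ?S)" by simp
  \<comment> \<open>One actual curve is what pins down \<eta>; without it every matrix would satisfy
    the description.\<close>
  obtain \<gamma> where \<gamma>: "stiefel_curve p n Y \<xi> \<gamma>" using stiefel_curve_exists[OF Y \<xi>] .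
  show ?thesis
    unfolding rhess_def eq[symmetric]
  proof (rule the_equality)
    fix \<eta>
    assume "\<forall>\<gamma>. stiefel_curve p n Y \<xi> \<gamma> \<longrightarrow> (\<exists>V. ?P \<gamma> V \<and> \<eta> = proj Y V)"
    with \<gamma> obtain V' where "?P \<gamma> V'" "\<eta> = proj Y V'" by blast
    with has_mat_derivative_unique[OF V[OF \<gamma>]] show "\<eta> = proj Y ?V" by blast
  qed (use V in blast)
qed

end

section \<open>Vectorisation\<close>

text \<open>Division with remainder by \<open>b\<close> cuts the range into \<open>c\<close>
  consecutive blocks of length \<open>b\<close>. This is the bridge from positions in a stacked
  vector to pairs of indices.\<close>

lemma sum_div_mod:
  fixes f :: "nat \<Rightarrow> nat \<Rightarrow> 'a :: comm_monoid_add"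
  shows "(\<Sum>k<c * b. f (k div b) (k mod b)) = (\<Sum>x<c. \<Sum>y<b. f x y)"
proof (cases "b = 0")
  case False
  have "(\<Sum>k<c * b. f (k div b) (k mod b)) =
      (\<Sum>x<c. \<Sum>k\<in>{x * b..<x * b + b}. f (k div b) (k mod b))"
    by (simp add: sum.nat_group)
  also have "\<dots> = (\<Sum>x<c. \<Sum>y<b. f x y)"
  proof (rule sum.cong[OF refl])
    fix x
    show "(\<Sum>k\<in>{x * b..<x * b + b}. f (k div b) (k mod b)) = (\<Sum>y<b. f x y)"
      using False
      by (intro sum.reindex_bij_witness[where i = "\<lambda>y. x * b + y" and j = "\<lambda>k. k - x * b"])
        (auto simp: div_add1_eq mod_add_eq le_iff_add)
  qed
  finally show ?thesis .
qed auto

lemma div_less_of_less_mult: "(k :: nat) < a * b \<Longrightarrow> k div b < a"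
  by (simp add: less_mult_imp_div_less)

lemma mod_less_of_less_mult: "(k :: nat) < a * b \<Longrightarrow> k mod b < b"
  by (cases "b = 0") auto

lemma mvec_dim [simp]: "dim_vec (mvec W) = dim_row W * dim_col W"
  by (simp add: mvec_def)

lemma mvec_carrier: "W \<in> carrier_mat r c \<Longrightarrow> mvec W \<in> carrier_vec (c * r)"
  by (auto simp: mvec_def)

lemma mvec_index: "k < dim_col W * dim_row W \<Longrightarrow> mvec W $ k = W $$ (k mod dim_row W, k div dim_row W)"
  by (simp add: mvec_def mult.commute)

lemma mvec_index_pair:
  assumes "i < dim_row W" "j < dim_col W"
  shows "mvec W $ (j * dim_row W + i) = W $$ (i, j)"
proof -
  have "j * dim_row W + i < dim_row W * dim_col W"
  proof -
    have "j * dim_row W + i < Suc j * dim_row W" using assms by simp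
    also have "\<dots> \<le> dim_col W * dim_row W" using assms by (intro mult_right_mono) auto
    finally show ?thesis by (simp add: mult.commute)
  qed
  thus ?thesis using assms by (simp add: mvec_def)
qed

lemma mvec_inject:
  assumes "V \<in> carrier_mat r c" "W \<in> carrier_mat r c" "mvec V = mvec W"
  shows "V = W"
proof (rule eq_matI, goal_cases)
  case (1 i j)
  with assms show ?case
    using mvec_index_pair[of i V j] mvec_index_pair[of i W j] by auto
qed (use assms in auto)

lemma mult_mat_vec_entry:
  "i < dim_row K \<Longrightarrow> (K *\<^sub>v x) $ i = (\<Sum>k<dim_vec x. K $$ (i, k) * x $ k)" if "dim_col K = dim_vec x"
  using that by (simp add: scalar_prod_def atLeast0LessThan)

lemma kron_dim [simp]:
  "dim_row (P \<otimes>\<^sub>k Q) = dim_row P * dim_row Q" "dim_col (P \<otimes>\<^sub>k Q) = dim_col P * dim_col Q"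
  by (simp_all add: kron_def)

text \<open>Once positions are read as column-row pairs through \<open>div\<close> and
  \<open>mod\<close>, the entry is a double sum over the entries of X, which is the iterated
  product. The left Kronecker factor acts on column indices because \<open>mvec\<close> stacks
  columns.\<close>

lemma kron_mult_mvec:
  assumes "dim_col P = dim_row X" "dim_col Q = dim_col X"
  shows "(Q \<otimes>\<^sub>k P) *\<^sub>v mvec X = mvec (P * X * Q\<^sup>T)"
proof (rule eq_vecI, goal_cases)
  case (1 k)
  hence k: "k < dim_row Q * dim_row P" by (simp add: mult.commute)
  let ?x = "k div dim_row P" and ?y = "k mod dim_row P"
  have xy: "?x < dim_row Q" "?y < dim_row P"
    using k by (auto intro: div_less_of_less_mult mod_less_of_less_mult)
  have "((Q \<otimes>\<^sub>k P) *\<^sub>v mvec X) $ k = (\<Sum>m<dim_col X * dim_row X.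
      Q $$ (?x, m div dim_row X) * P $$ (?y, m mod dim_row X) * X $$ (m mod dim_row X, m div dim_row X))"
    using k assms by (subst mult_mat_vec_entry) (auto simp: mult.commute mvec_index kron_def intro!: sum.cong)
  also have "\<dots> = (\<Sum>a<dim_col X. \<Sum>b<dim_row X. Q $$ (?x, a) * P $$ (?y, b) * X $$ (b, a))"
    by (rule sum_div_mod)
  also have "\<dots> = (\<Sum>a<dim_col X. (\<Sum>b<dim_row X. P $$ (?y, b) * X $$ (b, a)) * Q $$ (?x, a))"
    by (simp add: sum_distrib_right sum_distrib_left mult_ac)
  also have "\<dots> = (P * X * Q\<^sup>T) $$ (?y, ?x)"
    using assms xy by (simp add: index_mult_sum del: index_mult_mat(1))
  also have "\<dots> = mvec (P * X * Q\<^sup>T) $ k"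
    using k by (simp add: mvec_index del: index_mult_mat(1))
  finally show ?case .
qed (simp add: mult.commute)

lemma Delta_dim [simp]: "dim_row (Delta m) = m * m" "dim_col (Delta m) = m * m"
  by (simp_all add: Delta_def)

lemma Delta_index:
  assumes "k < m * m" "k' < m * m"
  shows "Delta m $$ (k, k') = (if k = k' \<and> k div m = k mod m then 1 else 0)"
proof -
  have lt: "k div m < m" "k mod m < m" "k' div m < m" "k' mod m < m"
    using assms by (auto intro: div_less_of_less_mult mod_less_of_less_mult)
  have eq: "k = k' \<longleftrightarrow> k div m = k' div m \<and> k mod m = k' mod m"
    by (metis div_mult_mod_eq)
  have "Delta m $$ (k, k') = (\<Sum>i\<in>{1..m}. (Emat m m i i \<otimes>\<^sub>k Emat m m i i) $$ (k, k'))"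
    using assms by (simp add: Delta_def msum_index)
  \<comment> \<open>\<open>Emat\<close> counts from 1, so only the summand with
    \<open>i = Suc (k div m)\<close> can survive.\<close>
  also have "\<dots> = (\<Sum>i\<in>{1..m}. if Suc (k div m) = i then
      (if k = k' \<and> k div m = k mod m then 1 else 0) else 0)"
    using assms lt eq by (intro sum.cong refl) (auto simp: kron_def Emat_def)
  also have "\<dots> = (if k = k' \<and> k div m = k mod m then 1 else 0)"
    using lt by (subst sum.delta') auto
  finally show ?thesis .
qed

lemma Delta_mult_mvec:
  assumes "W \<in> carrier_mat m m"
  shows "Delta m *\<^sub>v mvec W = mvec (diag_part W)"
proof (rule eq_vecI, goal_cases)
  case (1 k)
  hence k: "k < m * m" using assms by simp
  have "k div m < m" "k mod m < m"
    using k by (auto intro: div_less_of_less_mult mod_less_of_less_mult)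
  moreover have "(Delta m *\<^sub>v mvec W) $ k = (\<Sum>k'<m * m. Delta m $$ (k, k') * mvec W $ k')"
    using k assms by (subst mult_mat_vec_entry) auto
  moreover have "\<dots> = (\<Sum>k'<m * m. if k = k' then
      (if k div m = k mod m then W $$ (k mod m, k div m) else 0) else 0)"
    using k assms by (intro sum.cong refl) (auto simp: Delta_index mvec_index)
  moreover have "\<dots> = (if k div m = k mod m then W $$ (k mod m, k div m) else 0)"
    using k by (subst sum.delta') auto
  ultimately show ?case using k assms by (auto simp: mvec_index diag_part_index)
qed (use assms in auto)

section \<open>Numbering the strictly lower triangle\<close>

definition lower_pairs :: "nat \<Rightarrow> (nat \<times> nat) set" where
  "lower_pairs m = {(i, j). j < i \<and> i < m}"

text \<open>The number of subdiagonal entries in the columns before \<open>j\<close>, that is, the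
  0-based position at which column \<open>j\<close> starts in \<open>veck\<close>.\<close>

definition veck_offset :: "nat \<Rightarrow> nat \<Rightarrow> nat" where
  "veck_offset m j = (\<Sum>k<j. m - Suc k)"

definition veck_index :: "nat \<Rightarrow> nat \<times> nat \<Rightarrow> nat" where
  "veck_index m = (\<lambda>(i, j). veck_offset m j + (i - Suc j))"

lemma finite_lower_pairs [simp]: "finite (lower_pairs m)"
  by (rule finite_subset[of _ "{..<m} \<times> {..<m}"]) (auto simp: lower_pairs_def)

lemma veck_offset_Suc: "veck_offset m (Suc j) = veck_offset m j + (m - Suc j)"
  by (simp add: veck_offset_def)

lemma veck_offset_mono: "j \<le> j' \<Longrightarrow> veck_offset m j \<le> veck_offset m j'"
  unfolding veck_offset_def by (intro sum_mono2) auto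

text \<open>The quadratic formula j m - j(j+1)/2 for the offset, doubled and rearranged so that
  neither subtraction nor division on \<open>nat\<close> appears.\<close>

lemma veck_offset_closed: "j \<le> m \<Longrightarrow> 2 * veck_offset m j + j * (j + 1) = 2 * (j * m)"
proof (induction j)
  case (Suc j)
  then obtain d where "m = Suc j + d" by (metis le_Suc_ex)
  with Suc show ?case by (simp add: veck_offset_Suc algebra_simps)
qed (simp add: veck_offset_def)

lemma veck_offset_full: "veck_offset m m = m * (m - 1) div 2"
proof (cases m)
  case (Suc k)
  have "2 * veck_offset m m = m * (m - 1)"
    using veck_offset_closed[of m m] Suc by (simp add: algebra_simps)
  thus ?thesis by simp
qed (simp add: veck_offset_def)

lemma veck_index_less: "j < i \<Longrightarrow> i < m \<Longrightarrow> veck_index m (i, j) < veck_offset m (Suc j)"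
  by (simp add: veck_index_def veck_offset_Suc)

lemma veck_index_surj: "k < veck_offset m J \<Longrightarrow> \<exists>i j. j < J \<and> j < i \<and> i < m \<and> k = veck_index m (i, j)"
proof (induction J)
  case (Suc J)
  show ?case
  proof (cases "k < veck_offset m J")
    case True
    with Suc.IH show ?thesis by (meson less_SucI)
  next
    case False
    \<comment> \<open>The position lies in the block of column \<open>J\<close>; its distance from
      the start of the block is counted from row \<open>Suc J\<close>, the first one below the
      diagonal.\<close>
    with Suc.prems show ?thesis
      by (intro exI[of _ "k - veck_offset m J + Suc J"] exI[of _ J])
        (auto simp: veck_index_def veck_offset_Suc)
  qed
qed (simp add: veck_offset_def)

text \<open>The columns occupy consecutive blocks, and every position of one column precedes the
  start of the next; hence injectivity. Sums over the columns of \<open>Dmat\<close> are re-indexed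
  by this bijection.\<close>

lemma bij_betw_veck_index:
  "bij_betw (veck_index m) (lower_pairs m) {..<m * (m - 1) div 2}"
  unfolding veck_offset_full[symmetric] bij_betw_def
proof
  show "inj_on (veck_index m) (lower_pairs m)"
  proof (rule inj_onI, clarify)
    fix i j i' j'
    assume a: "(i, j) \<in> lower_pairs m" "(i', j') \<in> lower_pairs m"
      "veck_index m (i, j) = veck_index m (i', j')"
    have disj: "veck_index m (x, y) < veck_index m (x', y')"
      if "(x, y) \<in> lower_pairs m" "(x', y') \<in> lower_pairs m" "y < y'" for x y x' y'
    proof -
      have "veck_index m (x, y) < veck_offset m (Suc y)"
        using that by (intro veck_index_less) (auto simp: lower_pairs_def)
      also have "\<dots> \<le> veck_offset m y'" using that by (intro veck_offset_mono) simp
      finally show ?thesis by (simp add: veck_index_def)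
    qed
    have "j = j'" using disj[of i j i' j'] disj[of i' j' i j] a by (metis less_irrefl linorder_neqE_nat)
    with a show "i = i' \<and> j = j'" by (auto simp: veck_index_def lower_pairs_def)
  qed
  show "veck_index m ` lower_pairs m = {..<veck_offset m m}"
  proof (intro equalityI subsetI)
    fix k assume "k \<in> veck_index m ` lower_pairs m"
    then obtain i j where ij: "j < i" "i < m" "k = veck_index m (i, j)"
      by (auto simp: lower_pairs_def)
    have "k < veck_offset m (Suc j)" using ij by (simp add: veck_index_less)
    also have "\<dots> \<le> veck_offset m m" using ij by (intro veck_offset_mono) simp
    finally show "k \<in> {..<veck_offset m m}" by simp
  next
    fix k assume "k \<in> {..<veck_offset m m}"
    then obtain i j where "j < i" "i < m" "k = veck_index m (i, j)"
      using veck_index_surj[of k m m] by blast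
    thus "k \<in> veck_index m ` lower_pairs m" by (auto simp: lower_pairs_def)
  qed
qed

lemma length_below_diagonal:
  "length (concat (map (\<lambda>j. map (g j) [Suc j..<m]) [0..<J])) = veck_offset m J"
  by (induction J) (simp_all add: veck_offset_Suc, simp add: veck_offset_def)

text \<open>Raising \<open>J\<close> by one appends one column to the list, so an entry is found
  either in the old part, by induction, or in the appended column at its offset.\<close>

lemma nth_below_diagonal:
  "j < J \<Longrightarrow> j < i \<Longrightarrow> i < m \<Longrightarrow>
    concat (map (\<lambda>j. map (g j) [Suc j..<m]) [0..<J]) ! veck_index m (i, j) = g j i"
proof (induction J)
  case (Suc J)
  show ?case
  proof (cases "j < J")
    case True
    have "veck_index m (i, j) < veck_offset m (Suc j)" using Suc by (simp add: veck_index_less)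
    also have "\<dots> \<le> veck_offset m J" using True by (intro veck_offset_mono) simp
    finally show ?thesis
      using Suc True by (simp add: nth_append length_below_diagonal)
  next
    case False
    with Suc.prems have "j = J" by simp
    thus ?thesis using Suc.prems
      by (auto simp: nth_append length_below_diagonal veck_index_def)
  qed
qed simp

lemma veck_dim [simp]: "S \<in> carrier_mat m m \<Longrightarrow> dim_vec (veck S) = m * (m - 1) div 2"
  by (simp add: veck_def length_below_diagonal veck_offset_full)

lemma veck_carrier: "S \<in> carrier_mat m m \<Longrightarrow> veck S \<in> carrier_vec (m * (m - 1) div 2)"
  by (intro carrier_vecI veck_dim)

lemma veck_nth:
  "S \<in> carrier_mat m m \<Longrightarrow> ij \<in> lower_pairs m \<Longrightarrow> veck S $ veck_index m ij = S $$ ij"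
  by (auto simp: lower_pairs_def veck_def vec_of_list_index nth_below_diagonal)

lemma eq_vec_veckI:
  assumes "x \<in> carrier_vec (m * (m - 1) div 2)" "y \<in> carrier_vec (m * (m - 1) div 2)"
    and "\<And>ij. ij \<in> lower_pairs m \<Longrightarrow> x $ veck_index m ij = y $ veck_index m ij"
  shows "x = y"
proof (rule eq_vecI)
  fix k assume "k < dim_vec y"
  hence "k \<in> veck_index m ` lower_pairs m"
    using assms(2) bij_betw_imp_surj_on[OF bij_betw_veck_index, of m] by auto
  thus "x $ k = y $ k" using assms(3) by auto
qed (use assms in auto)

lemma skew_matsD:
  assumes "S \<in> skew_mats m"
  shows "S \<in> carrier_mat m m" "S\<^sup>T = - S"
    "i < m \<Longrightarrow> j < m \<Longrightarrow> S $$ (j, i) = - S $$ (i, j)"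
proof -
  show *: "S \<in> carrier_mat m m" "S\<^sup>T = - S" using assms by (auto simp: skew_mats_def)
  show "S $$ (j, i) = - S $$ (i, j)" if "i < m" "j < m"
    using arg_cong[OF *(2), of "\<lambda>M. M $$ (i, j)"] *(1) that by simp
qed

lemma skew_matsI:
  assumes "S \<in> carrier_mat m m" "\<And>i j. i < m \<Longrightarrow> j < m \<Longrightarrow> S $$ (j, i) = - S $$ (i, j)"
  shows "S \<in> skew_mats m"
proof -
  have "S\<^sup>T = - S"
  proof (rule eq_matI, goal_cases)
    case (1 i j)
    hence "i < m" "j < m" using assms(1) by auto
    with assms(2)[OF this] assms(1) show ?case by simp
  qed (use assms(1) in auto)
  with assms(1) show ?thesis by (simp add: skew_mats_def)
qed

text \<open>Entries above the diagonal are the negatives of those below it, and the diagonal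
  vanishes because s = -s.\<close>

lemma veck_inject:
  assumes "S \<in> skew_mats m" "T \<in> skew_mats m" "veck S = veck T"
  shows "S = T"
proof (rule eq_matI)
  note c = skew_matsD(1)[OF assms(1)] skew_matsD(1)[OF assms(2)]
  have lower: "S $$ (i, j) = T $$ (i, j)" if "j < i" "i < m" for i j
    using that veck_nth[OF c(1), of "(i, j)"] veck_nth[OF c(2), of "(i, j)"] assms(3)
    by (simp add: lower_pairs_def)
  fix i j assume "i < dim_row T" "j < dim_col T"
  hence ij: "i < m" "j < m" using c by auto
  consider "j < i" | "i < j" | "i = j" by linarith
  thus "S $$ (i, j) = T $$ (i, j)"
  proof cases
    case 2
    thus ?thesis using lower[of i j] skew_matsD(3)[OF assms(1), of j i]
      skew_matsD(3)[OF assms(2), of j i] ij by simp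
  next
    case 3
    thus ?thesis using skew_matsD(3)[OF assms(1), of i i] skew_matsD(3)[OF assms(2), of i i] ij by simp
  qed (use lower ij in auto)
qed (use skew_matsD(1)[OF assms(1)] skew_matsD(1)[OF assms(2)] in auto)

text \<open>Allows the upper part of an arbitrary solution of the linear system to be read as
  coordinates of a skew-symmetric matrix.\<close>

lemma veck_surj:
  assumes "x \<in> carrier_vec (m * (m - 1) div 2)"
  obtains S where "S \<in> skew_mats m" "veck S = x"
proof -
  define S where "S = mat m m (\<lambda>(i, j). if j < i then x $ veck_index m (i, j)
    else if i < j then - x $ veck_index m (j, i) else 0)"
  have c: "S \<in> carrier_mat m m" by (simp add: S_def)
  have "S \<in> skew_mats m" by (rule skew_matsI) (auto simp: S_def)
  moreover have "veck S = x"
    by (rule eq_vec_veckI[OF veck_carrier[OF c] assms])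
      (use c in \<open>auto simp: veck_nth, auto simp: S_def lower_pairs_def\<close>)
  ultimately show ?thesis using that by blast
qed

section \<open>The matrix D\<close>

lemma Dmat_dim [simp]: "dim_row (Dmat m) = m * m" "dim_col (Dmat m) = m * (m - 1) div 2"
  by (simp_all add: Dmat_def)

text \<open>The formula in \<open>Dmat\<close> counts rows, columns and positions from 1, whereas
  \<open>veck_index\<close> counts from 0. The halving is exact because j(j+1) is even.\<close>

lemma Dmat_column_number:
  assumes "j < i" "i < m"
  shows "(Suc j * m + Suc i) - (Suc j * (Suc j + 1)) div 2 - m = Suc (veck_index m (i, j))"
proof -
  have "2 * veck_offset m j + j * (j + 1) = 2 * (j * m)"
    using assms by (intro veck_offset_closed) simp
  moreover have "2 * ((j * (j + 1)) div 2) = j * (j + 1)" by simp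
  ultimately have *: "veck_offset m j + (j * (j + 1)) div 2 = j * m" by linarith
  have "Suc j * (Suc j + 1) = j * (j + 1) + 2 * (j + 1)" by simp
  hence "(Suc j * (Suc j + 1)) div 2 = (j * (j + 1)) div 2 + (j + 1)" by simp
  with * assms show ?thesis by (simp add: veck_index_def)
qed

text \<open>By injectivity of \<open>veck_index\<close>, only the summand of \<open>Dmat\<close> for
  the pair (i, j) touches this column. Its two nonzero rows are recognised by uniqueness of the
  base-m digits of the row number.\<close>

lemma Dmat_index:
  assumes ij: "(i, j) \<in> lower_pairs m" and ab: "a < m" "b < m"
  shows "Dmat m $$ (b * m + a, veck_index m (i, j)) =
    (if (i, j) = (a, b) then 1 else 0) - (if (i, j) = (b, a) then 1 else 0)"
proof -
  let ?r = "b * m + a"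
  have "?r < Suc b * m" using ab by simp
  also have "\<dots> \<le> m * m" using ab by (intro mult_right_mono) auto
  finally have r: "?r < m * m" .
  have c: "veck_index m (i, j) < m * (m - 1) div 2"
    using bij_betw_apply[OF bij_betw_veck_index ij] by simp
  have pair: "y * m + x = y' * m + x' \<longleftrightarrow> x = x' \<and> y = y'" if "x < m" "x' < m" for x y x' y'
  proof
    assume *: "y * m + x = y' * m + x'"
    have "(y * m + x) mod m = x" "(y' * m + x') mod m = x'" 
      "(y * m + x) div m = y" "(y' * m + x') div m = y'" using that by auto
    with * show "x = x' \<and> y = y'" by metis
  qed auto
  let ?F = "\<lambda>(i', j'). let k = (j' * m + i') - (j' * (j' + 1)) div 2 - m in
        Emat (m * m) (m * (m - 1) div 2) (m * (j' - 1) + i') k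
        - Emat (m * m) (m * (m - 1) div 2) (m * (i' - 1) + j') k"
  have img: "{(i, j). m \<ge> i \<and> i > j \<and> j \<ge> 1} = (\<lambda>(i, j). (Suc i, Suc j)) ` lower_pairs m"
  proof (intro equalityI subsetI, clarify)
    fix i j assume "i \<le> m" "j < i" "1 \<le> j"
    thus "(i, j) \<in> (\<lambda>(i, j). (Suc i, Suc j)) ` lower_pairs m"
      by (intro image_eqI[of _ _ "(i - 1, j - 1)"]) (auto simp: lower_pairs_def)
  qed (auto simp: lower_pairs_def)
  have inj: "inj_on (\<lambda>(i, j). (Suc i, Suc j)) (lower_pairs m)" by (auto simp: inj_on_def)
  have "Dmat m $$ (?r, veck_index m (i, j)) =
      (\<Sum>ij'\<in>lower_pairs m. ?F (Suc (fst ij'), Suc (snd ij')) $$ (?r, veck_index m (i, j)))"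
    unfolding Dmat_def msum_index[OF r c] img sum.reindex[OF inj]
    by (simp add: case_prod_unfold o_def)
  also have "\<dots> = (\<Sum>ij'\<in>lower_pairs m. if (i, j) = ij' then
      (if (i, j) = (a, b) then 1 else 0) - (if (i, j) = (b, a) then 1 else 0) else 0)"
  proof (intro sum.cong refl)
    fix ij' assume "ij' \<in> lower_pairs m"
    then obtain i' j' where eq: "ij' = (i', j')" and ij': "(i', j') \<in> lower_pairs m"
      by (cases ij') auto
    hence k: "(Suc j' * m + Suc i') - (Suc j' * (Suc j' + 1)) div 2 - m = Suc (veck_index m (i', j'))"
      by (intro Dmat_column_number) (auto simp: lower_pairs_def)
    have idx: "veck_index m (i, j) = veck_index m (i', j') \<longleftrightarrow> (i, j) = (i', j')"
      using bij_betw_imp_inj_on[OF bij_betw_veck_index] ij ij' by (metis inj_onD)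
    have "?F (Suc i', Suc j') $$ (?r, veck_index m (i, j)) =
        (if ?r = j' * m + i' \<and> (i, j) = (i', j') then 1 else 0)
        - (if ?r = i' * m + j' \<and> (i, j) = (i', j') then 1 else 0)"
      unfolding Let_def prod.case k using r c idx
      by (auto simp: Emat_def mult.commute)
    also have "\<dots> = (if (i, j) = (i', j') then
      (if (i, j) = (a, b) then 1 else 0) - (if (i, j) = (b, a) then 1 else 0) else 0)"
      using ab ij' by (auto simp: pair lower_pairs_def)
    finally show "?F (Suc (fst ij'), Suc (snd ij')) $$ (?r, veck_index m (i, j)) =
        (if (i, j) = ij' then
      (if (i, j) = (a, b) then 1 else 0) - (if (i, j) = (b, a) then 1 else 0) else 0)"
      unfolding eq fst_conv snd_conv .
  qed
  also have "\<dots> = (if (i, j) = (a, b) then 1 else 0) - (if (i, j) = (b, a) then 1 else 0)"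
    using ij by (subst sum.delta') auto
  finally show ?thesis .
qed

lemma Dmat_mult_veck:
  assumes S: "S \<in> skew_mats m"
  shows "Dmat m *\<^sub>v veck S = mvec S"
proof (rule eq_vecI, goal_cases)
  note c = skew_matsD(1)[OF S]
  {
    case (1 k)
    hence k: "k < m * m" using c by simp
    define a b where "a = k mod m" and "b = k div m"
    have ab: "a < m" "b < m" and k_eq: "k = b * m + a"
      using k by (auto simp: a_def b_def intro: div_less_of_less_mult mod_less_of_less_mult)
    have "(Dmat m *\<^sub>v veck S) $ k = (\<Sum>c<m * (m - 1) div 2. Dmat m $$ (k, c) * veck S $ c)"
      using k c by (subst mult_mat_vec_entry) auto
    also have "\<dots> = (\<Sum>ij\<in>lower_pairs m. Dmat m $$ (k, veck_index m ij) * veck S $ veck_index m ij)"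
      by (rule sum.reindex_bij_betw[OF bij_betw_veck_index, symmetric])
    also have "\<dots> = (\<Sum>ij\<in>lower_pairs m. (if ij = (a, b) then S $$ (a, b) else 0)
        - (if ij = (b, a) then S $$ (b, a) else 0))"
    proof (rule sum.cong[OF refl])
      fix ij assume ij: "ij \<in> lower_pairs m"
      obtain i j where ij_eq: "ij = (i, j)" by (cases ij)
      have 1: "veck S $ veck_index m ij = S $$ (i, j)" using veck_nth[OF c ij] ij_eq by simp
      have 2: "Dmat m $$ (k, veck_index m ij) =
          (if (i, j) = (a, b) then 1 else 0) - (if (i, j) = (b, a) then 1 else 0)"
        using Dmat_index[OF ij[unfolded ij_eq] ab] by (simp only: k_eq ij_eq)
      show "Dmat m $$ (k, veck_index m ij) * veck S $ veck_index m ij =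
          (if ij = (a, b) then S $$ (a, b) else 0) - (if ij = (b, a) then S $$ (b, a) else 0)"
        unfolding 1 2 left_diff_distrib unfolding ij_eq
        by (intro arg_cong2[where f = "(-)"]) auto
    qed
    also have "\<dots> = (if (a, b) \<in> lower_pairs m then S $$ (a, b) else 0)
        - (if (b, a) \<in> lower_pairs m then S $$ (b, a) else 0)"
      by (simp add: sum_subtractf)
    \<comment> \<open>Below the diagonal only the first term is present; above it only the second,
      and -S_ba = S_ab; on the diagonal neither, and S_aa = 0.\<close>
    also have "\<dots> = S $$ (a, b)"
      using skew_matsD(3)[OF S ab] skew_matsD(3)[OF S ab(1) ab(1)] ab 
      by (cases a b rule: linorder_cases) (auto simp: lower_pairs_def)
    also have "\<dots> = mvec S $ k"
      using k c by (simp add: mvec_index a_def b_def)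
    finally show ?case .
  }
qed (use skew_matsD(1)[OF S] in auto)

text \<open>The column of D for (i, j), with its entries 1 and -1, pairs with vec W to W_ij - W_ji.
  The symmetric part of W is thus invisible to D^T.\<close>

lemma Dmat_transpose_mult_mvec:
  assumes W: "W \<in> carrier_mat m m"
  shows "(Dmat m)\<^sup>T *\<^sub>v mvec W = veck (W - W\<^sup>T)"
proof (rule eq_vec_veckI)
  have c: "W - W\<^sup>T \<in> carrier_mat m m" using W by auto
  show "(Dmat m)\<^sup>T *\<^sub>v mvec W \<in> carrier_vec (m * (m - 1) div 2)" by (intro carrier_vecI) simp
  show "veck (W - W\<^sup>T) \<in> carrier_vec (m * (m - 1) div 2)" by (rule veck_carrier[OF c])
  fix ij assume ij: "ij \<in> lower_pairs m"
  obtain i j where ij_eq: "ij = (i, j)" and lt: "i < m" "j < m" "j < i" 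
    using ij by (cases ij) (auto simp: lower_pairs_def)
  have v: "veck_index m ij < m * (m - 1) div 2"
    using bij_betw_apply[OF bij_betw_veck_index ij] by simp
  have "((Dmat m)\<^sup>T *\<^sub>v mvec W) $ veck_index m ij =
      (\<Sum>k<m * m. Dmat m $$ (k, veck_index m ij) * mvec W $ k)"
    using v W by (subst mult_mat_vec_entry) auto
  also have "\<dots> = (\<Sum>k<m * m. Dmat m $$ (k div m * m + k mod m, veck_index m ij) * W $$ (k mod m, k div m))"
    using W by (intro sum.cong refl) (auto simp: mvec_index)
  also have "\<dots> = (\<Sum>b<m. \<Sum>a<m. Dmat m $$ (b * m + a, veck_index m ij) * W $$ (a, b))"
    by (rule sum_div_mod)
  also have "\<dots> = (\<Sum>b<m. \<Sum>a<m. (if a = i then if b = j then W $$ (i, j) else 0 else 0)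
      - (if a = j then if b = i then W $$ (j, i) else 0 else 0))"
    by (intro sum.cong refl) (use ij lt in \<open>auto simp: ij_eq Dmat_index\<close>)
  also have "\<dots> = W $$ (i, j) - W $$ (j, i)"
    using lt by (simp add: sum_subtractf)
  also have "\<dots> = veck (W - W\<^sup>T) $ veck_index m ij"
    unfolding veck_nth[OF c ij] using W lt by (simp add: ij_eq)
  finally show "((Dmat m)\<^sup>T *\<^sub>v mvec W) $ veck_index m ij = veck (W - W\<^sup>T) $ veck_index m ij" .
qed

section \<open>Linearity of matrix-vector products and of vectorisation\<close>

lemma mult_mat_vec_assoc_dim:
  "dim_col A = dim_row B \<Longrightarrow> dim_col B = dim_vec x \<Longrightarrow> (A * B) *\<^sub>v x = A *\<^sub>v (B *\<^sub>v (x :: real vec))"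
  by (rule assoc_mult_mat_vec[of _ "dim_row A" "dim_row B" _ "dim_vec x"])
    (auto intro: carrier_vecI)

lemma add_mult_vec_dim:
  "dim_row A = dim_row B \<Longrightarrow> dim_col A = dim_vec x \<Longrightarrow> dim_col B = dim_vec x \<Longrightarrow>
    (A + B) *\<^sub>v x = A *\<^sub>v x + B *\<^sub>v (x :: real vec)"
  by (rule add_mult_distrib_mat_vec[of _ "dim_row A" "dim_vec x"]) (auto intro: carrier_vecI)

lemma minus_mult_vec_dim:
  "dim_row A = dim_row B \<Longrightarrow> dim_col A = dim_vec x \<Longrightarrow> dim_col B = dim_vec x \<Longrightarrow>
    (A - B) *\<^sub>v x = A *\<^sub>v x - B *\<^sub>v (x :: real vec)"
  by (rule minus_mult_distrib_mat_vec[of _ "dim_row A" "dim_vec x"]) (auto intro: carrier_vecI)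

lemma mult_add_vec_dim:
  "dim_vec x = dim_vec y \<Longrightarrow> dim_col A = dim_vec y \<Longrightarrow> A *\<^sub>v (x + y) = A *\<^sub>v x + A *\<^sub>v (y :: real vec)"
  by (rule mult_add_distrib_mat_vec[of _ "dim_row A" "dim_vec y"]) (auto intro: carrier_vecI)

lemma smult_mult_vec_dim:
  "dim_col A = dim_vec x \<Longrightarrow> (k \<cdot>\<^sub>m A) *\<^sub>v x = k \<cdot>\<^sub>v (A *\<^sub>v (x :: real vec))"
  by (rule eq_vecI) (auto simp: scalar_prod_def sum_distrib_left mult.assoc)

lemmas mat_vec_laws = mult_mat_vec_assoc_dim add_mult_vec_dim minus_mult_vec_dim
  mult_add_vec_dim smult_mult_vec_dim

lemma mult_uminus_dim: "dim_col A = dim_row B \<Longrightarrow> A * (- B) = - (A * (B :: real mat))"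
  by (rule eq_matI) (auto simp: scalar_prod_def sum_negf)

lemma mult_zero_dim: "dim_col A = r \<Longrightarrow> A * 0\<^sub>m r c = (0\<^sub>m (dim_row A) c :: real mat)"
  by (rule eq_matI) auto

lemma zero_mult_dim: "dim_row A = c \<Longrightarrow> 0\<^sub>m r c * A = (0\<^sub>m r (dim_col A) :: real mat)"
  by (rule eq_matI) (auto simp: scalar_prod_def)

lemma mvec_eqI:
  assumes "dim_vec x = dim_col W * dim_row W"
    and "\<And>k. k < dim_col W * dim_row W \<Longrightarrow> k mod dim_row W < dim_row W \<Longrightarrow>
      k div dim_row W < dim_col W \<Longrightarrow> W $$ (k mod dim_row W, k div dim_row W) = x $ k"
  shows "mvec W = x"
  using assms
  by (intro eq_vecI) (auto simp: mvec_index mult.commute[of "dim_row W"]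
    intro: div_less_of_less_mult mod_less_of_less_mult)

lemma mvec_add:
  "dim_row V = dim_row W \<Longrightarrow> dim_col V = dim_col W \<Longrightarrow> mvec (V + W) = mvec V + mvec W"
  by (rule mvec_eqI) (auto simp: mvec_index mult.commute)

lemma mvec_minus:
  "dim_row V = dim_row W \<Longrightarrow> dim_col V = dim_col W \<Longrightarrow> mvec (V - W) = mvec V - mvec W"
  by (rule mvec_eqI) (auto simp: mvec_index mult.commute)

lemma mvec_smult: "mvec (k \<cdot>\<^sub>m W) = k \<cdot>\<^sub>v mvec W"
  by (rule mvec_eqI) (auto simp: mvec_index mult.commute)

lemma mvec_uminus: "mvec (- W) = - mvec W"
  by (rule mvec_eqI) (auto simp: mvec_index mult.commute)

lemma mvec_surj:
  assumes "x \<in> carrier_vec (c * r)"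
  obtains W where "W \<in> carrier_mat r c" "mvec W = x"
proof -
  define W where "W = mat r c (\<lambda>(i, j). x $ (j * r + i))"
  have "mvec W = x"
    by (rule mvec_eqI) (use assms in \<open>auto simp: W_def\<close>)
  thus ?thesis using that[of W] by (simp add: W_def)
qed

lemma veck_smult:
  assumes "S \<in> carrier_mat m m"
  shows "veck (k \<cdot>\<^sub>m S) = k \<cdot>\<^sub>v veck S"
proof (rule eq_vec_veckI)
  have c: "k \<cdot>\<^sub>m S \<in> carrier_mat m m" using assms by simp
  show "veck (k \<cdot>\<^sub>m S) \<in> carrier_vec (m * (m - 1) div 2)" by (rule veck_carrier[OF c])
  show "k \<cdot>\<^sub>v veck S \<in> carrier_vec (m * (m - 1) div 2)" using veck_carrier[OF assms] by simp
  fix ij assume ij: "ij \<in> lower_pairs m"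
  have "veck_index m ij < m * (m - 1) div 2"
    using bij_betw_apply[OF bij_betw_veck_index ij] by simp
  thus "veck (k \<cdot>\<^sub>m S) $ veck_index m ij = (k \<cdot>\<^sub>v veck S) $ veck_index m ij"
    unfolding veck_nth[OF c ij] using assms ij by (auto simp: veck_nth lower_pairs_def)
qed

lemma veck_uminus:
  assumes "S \<in> carrier_mat m m"
  shows "veck (- S) = - veck S"
proof -
  have "- S = (-1) \<cdot>\<^sub>m S" by (rule eq_matI) auto
  moreover have "- veck S = (-1) \<cdot>\<^sub>v veck S" by (rule eq_vecI) auto
  ultimately show ?thesis using veck_smult[OF assms] by simp
qed

text \<open>Carries a vectorised identity from the single summands to the sum over \<open>l\<close>;
  the explicit formats cover the empty sum.\<close>

lemma msum_mult_mvec: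
  assumes X: "X \<in> carrier_mat s t"
    and F: "\<And>l. l \<in> S \<Longrightarrow> F l \<in> carrier_mat (c * r) (t * s)"
    and G: "\<And>l. l \<in> S \<Longrightarrow> G l \<in> carrier_mat r c"
    and FG: "\<And>l. l \<in> S \<Longrightarrow> F l *\<^sub>v mvec X = mvec (G l)"
  shows "msum (c * r) (t * s) F S *\<^sub>v mvec X = mvec (msum r c G S)"
proof (rule eq_vecI, goal_cases)
  case (1 k)
  hence k: "k < c * r" by (simp add: mult.commute)
  have dv: "dim_vec (mvec X) = t * s" using X by (simp add: mult.commute)
  have "(msum (c * r) (t * s) F S *\<^sub>v mvec X) $ k =
      (\<Sum>i<t * s. \<Sum>l\<in>S. F l $$ (k, i) * mvec X $ i)"
    using k by (subst mult_mat_vec_entry) (simp_all add: dv msum_index sum_distrib_right del: mvec_dim)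
  also have "\<dots> = (\<Sum>l\<in>S. \<Sum>i<t * s. F l $$ (k, i) * mvec X $ i)"
    by (rule sum.swap)
  also have "\<dots> = (\<Sum>l\<in>S. (F l *\<^sub>v mvec X) $ k)"
  proof (rule sum.cong[OF refl])
    fix l assume "l \<in> S"
    hence "dim_col (F l) = dim_vec (mvec X)" "k < dim_row (F l)"
      using carrier_matD[OF F[of l]] k dv by auto
    thus "(\<Sum>i<t * s. F l $$ (k, i) * mvec X $ i) = (F l *\<^sub>v mvec X) $ k"
      by (simp only: mult_mat_vec_entry dv)
  qed
  also have "\<dots> = (\<Sum>l\<in>S. G l $$ (k mod r, k div r))"
    using FG G k by (intro sum.cong refl) (metis carrier_matD mvec_index)
  also have "\<dots> = mvec (msum r c G S) $ k"
    using k div_less_of_less_mult[OF k] mod_less_of_less_mult[OF k]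
    by (simp add: mvec_index msum_index)
  finally show ?case .
qed (simp add: mult.commute)

text \<open>The common shape of the four blocks. Read from right to left, the second product forms T
  X, keeps its diagonal through \<open>Delta\<close>, and multiplies by R from the left.\<close>

lemma hessian_kron_mult_mvec:
  assumes "Z \<in> carrier_mat p p" "P \<in> carrier_mat r s" "R \<in> carrier_mat r p" "T \<in> carrier_mat p s"
    "X \<in> carrier_mat s p"
  shows "(diag_part Z \<otimes>\<^sub>k P + 2 \<cdot>\<^sub>m ((1\<^sub>m p \<otimes>\<^sub>k R) * Delta p * (1\<^sub>m p \<otimes>\<^sub>k T))) *\<^sub>v mvec X =
    mvec (P * X * diag_part Z + 2 \<cdot>\<^sub>m (R * diag_part (T * X)))"
proof -
  have [simp]: "dim_row Z = p" "dim_col Z = p" "dim_row P = r" "dim_col P = s" "dim_row R = r"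
    "dim_col R = p" "dim_row T = p" "dim_col T = s" "dim_row X = s" "dim_col X = p"
    using assms by auto
  have 1: "(1\<^sub>m p \<otimes>\<^sub>k T) *\<^sub>v mvec X = mvec (T * X)"
    by (simp add: kron_mult_mvec right_one_dim)
  have 2: "Delta p *\<^sub>v mvec (T * X) = mvec (diag_part (T * X))"
    by (rule Delta_mult_mvec) auto
  have 3: "(1\<^sub>m p \<otimes>\<^sub>k R) *\<^sub>v mvec (diag_part (T * X)) = mvec (R * diag_part (T * X))"
    by (simp add: kron_mult_mvec right_one_dim)
  have 4: "(diag_part Z \<otimes>\<^sub>k P) *\<^sub>v mvec X = mvec (P * X * diag_part Z)"
    by (simp add: kron_mult_mvec)
  show ?thesis
    by (simp add: mat_vec_laws 1 2 3 4 mvec_add mvec_smult mult.commute)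
qed

lemma kron_one_mult_mvec:
  assumes "S \<in> carrier_mat p p" "S\<^sup>T = S" "X \<in> carrier_mat r p"
  shows "(S \<otimes>\<^sub>k 1\<^sub>m r) *\<^sub>v mvec X = mvec (X * S)"
  using assms by (subst kron_mult_mvec) (auto simp: left_one_dim)

lemma sym_part_smult_msum:
  assumes F: "\<And>l. l \<in> S \<Longrightarrow> F l \<in> carrier_mat p p"
  shows "sym_part (a \<cdot>\<^sub>m msum p p F S) = a \<cdot>\<^sub>m msum p p (\<lambda>l. sym_part (F l)) S"
proof (rule eq_matI, goal_cases)
  case (1 i j)
  hence ij: "i < p" "j < p" by auto
  have "(\<Sum>l\<in>S. sym_part (F l) $$ (i, j)) = (\<Sum>l\<in>S. (F l $$ (i, j) + F l $$ (j, i)) / 2)"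
    using F ij by (intro sum.cong refl sym_part_index) fastforce+
  also have "\<dots> = ((\<Sum>l\<in>S. F l $$ (i, j)) + (\<Sum>l\<in>S. F l $$ (j, i))) / 2"
    by (simp add: sum_divide_distrib[symmetric] sum.distrib)
  finally have *: "(\<Sum>l\<in>S. sym_part (F l) $$ (i, j)) =
      ((\<Sum>l\<in>S. F l $$ (i, j)) + (\<Sum>l\<in>S. F l $$ (j, i))) / 2" .
  show ?case using ij by (simp add: sym_part_index msum_index * distrib_left)
qed auto

lemma msum_minus:
  assumes F: "\<And>l. l \<in> S \<Longrightarrow> F l \<in> carrier_mat r c" and G: "\<And>l. l \<in> S \<Longrightarrow> G l \<in> carrier_mat r c"
  shows "msum r c F S - msum r c G S = msum r c (\<lambda>l. F l - G l) S"
proof (rule eq_matI, goal_cases)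
  case (1 i j)
  hence ij: "i < r" "j < c" by auto
  have "(\<Sum>l\<in>S. (F l - G l) $$ (i, j)) = (\<Sum>l\<in>S. F l $$ (i, j) - G l $$ (i, j))"
    using G ij by (intro sum.cong refl index_minus_mat) fastforce+
  thus ?case using ij by (simp add: msum_index sum_subtractf)
qed auto

lemma msum_add:
  assumes F: "\<And>l. l \<in> S \<Longrightarrow> F l \<in> carrier_mat r c" and G: "\<And>l. l \<in> S \<Longrightarrow> G l \<in> carrier_mat r c"
  shows "msum r c F S + msum r c G S = msum r c (\<lambda>l. F l + G l) S"
proof (rule eq_matI, goal_cases)
  case (1 i j)
  hence ij: "i < r" "j < c" by auto
  have "(\<Sum>l\<in>S. (F l + G l) $$ (i, j)) = (\<Sum>l\<in>S. F l $$ (i, j) + G l $$ (i, j))"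
    using G ij by (intro sum.cong refl index_add_mat) fastforce+
  thus ?case using ij by (simp add: msum_index sum.distrib)
qed auto

lemma diag_part_add:
  "dim_row V = dim_row W \<Longrightarrow> dim_col V = dim_row W \<Longrightarrow> dim_col W = dim_row W \<Longrightarrow>
    diag_part (V + W) = diag_part V + diag_part W"
  by (rule eq_matI) (auto simp: diag_part_index)

section \<open>Newton's equation in the frame of tangential and normal coordinates\<close>

text \<open>With \<open>q\<close> as a parameter and \<open>n = p + q\<close>, no truncated
  difference enters the calculations, and \<open>q = 0\<close> covers square Y uniformly.\<close>

locale stiefel_frame = symmetric_family n N A
  for n N :: nat and A :: "nat \<Rightarrow> real mat" +
  fixes p q :: nat and Y Yp :: "real mat"
  assumes n_eq: "n = p + q"
    and Y: "Y \<in> stiefel p n"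
    and Yp: "Yp \<in> carrier_mat n q"
    and Y_Yp: "Y\<^sup>T * Yp = 0\<^sub>m p q"
    and Yp_Yp: "Yp\<^sup>T * Yp = 1\<^sub>m q"
begin

lemma frame_dim [simp]:
  "dim_row Y = n" "dim_col Y = p" "dim_row Yp = n" "dim_col Yp = q"
  using stiefelD[OF Y] Yp by auto

lemma Yp_Y: "Yp\<^sup>T * Y = 0\<^sub>m q p"
  using arg_cong[OF Y_Yp, of transpose_mat] by (simp add: transpose_mult_dim)

text \<open>\<open>mat_laws\<close> nests products to the right, where the bare orthonormality
  relations no longer match; with a trailing factor they work as rewrite rules.\<close>

lemma frame_cancel:
  "dim_row X = p \<Longrightarrow> Y\<^sup>T * (Y * X) = X"
  "dim_row X = q \<Longrightarrow> Y\<^sup>T * (Yp * X) = 0\<^sub>m p (dim_col X)"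
  "dim_row X = p \<Longrightarrow> Yp\<^sup>T * (Y * X) = 0\<^sub>m q (dim_col X)"
  "dim_row X = q \<Longrightarrow> Yp\<^sup>T * (Yp * X) = X"
  by (simp_all add: stiefelD(4)[OF Y] Y_Yp Yp_Y Yp_Yp left_one_dim zero_mult_dim
    mult_assoc_dim[symmetric] del: assoc_mult_mat)

text \<open>\<open>1 - YY\<^sup>T - Y\<^sub>\<bottom>Y\<^sub>\<bottom>\<^sup>T\<close> is symmetric and idempotent, so its squared Frobenius norm equals its
  trace \<open>n - p - q = 0\<close>.\<close>

lemma frame_complete: "Y * Y\<^sup>T + Yp * Yp\<^sup>T = 1\<^sub>m n"
proof -
  define R where "R = 1\<^sub>m n - (Y * Y\<^sup>T + Yp * Yp\<^sup>T)"
  have [simp]: "dim_row R = n" "dim_col R = n" by (simp_all add: R_def)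
  have "R\<^sup>T = R" by (simp add: R_def mat_laws)
  moreover have "R * R = R"
    by (simp add: R_def mat_laws frame_cancel mult_zero_dim)
      (intro eq_matI, auto simp del: index_mult_mat(1))
  ultimately have "metric R R = mtrace R" by (simp add: metric_def)
  also have "\<dots> = mtrace (1\<^sub>m n) - (mtrace (Y * Y\<^sup>T) + mtrace (Yp * Yp\<^sup>T))"
    by (simp add: R_def mtrace_minus mtrace_add)
  also have "mtrace (Y * Y\<^sup>T) = mtrace (Y\<^sup>T * Y)" by (rule mtrace_mult_commute) auto
  also have "mtrace (Yp * Yp\<^sup>T) = mtrace (Yp\<^sup>T * Yp)" by (rule mtrace_mult_commute) auto
  finally have "metric R R = 0"
    by (simp add: stiefelD(4)[OF Y] Yp_Yp) (simp add: mtrace_def n_eq)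
  hence "R = 0\<^sub>m n n" by (intro metric_self_eq_zero) (auto intro: carrier_matI)
  hence "R $$ (i, j) = 0" if "i < n" "j < n" for i j using that by simp
  thus ?thesis by (intro eq_matI) (simp_all add: R_def del: index_mult_mat(1))
qed

lemma frame_decompose:
  assumes "V \<in> carrier_mat n c"
  shows "V = Y * (Y\<^sup>T * V) + Yp * (Yp\<^sup>T * V)"
proof -
  have "V = (Y * Y\<^sup>T + Yp * Yp\<^sup>T) * V" using assms by (simp add: frame_complete)
  also have "\<dots> = Y * (Y\<^sup>T * V) + Yp * (Yp\<^sup>T * V)" using assms by (simp add: mat_laws)
  finally show ?thesis .
qed

lemma tangent_frame:
  assumes "B \<in> skew_mats p" "C \<in> carrier_mat q p"
  shows "Y * B + Yp * C \<in> tangent p n Y"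
    and "Y\<^sup>T * (Y * B + Yp * C) = B" and "Yp\<^sup>T * (Y * B + Yp * C) = C"
proof -
  note B = skew_matsD(1,2)[OF assms(1)]
  have [simp]: "dim_row B = p" "dim_col B = p" "dim_row C = q" "dim_col C = p" using B assms by auto
  show 1: "Y\<^sup>T * (Y * B + Yp * C) = B" and "Yp\<^sup>T * (Y * B + Yp * C) = C"
    using B assms(2) by (simp_all add: mult_add_dim frame_cancel)
  have "(Y * B + Yp * C)\<^sup>T * Y = (Y\<^sup>T * (Y * B + Yp * C))\<^sup>T"
    by (subst transpose_mult_dim) auto
  hence "(Y * B + Yp * C)\<^sup>T * Y + Y\<^sup>T * (Y * B + Yp * C) = - B + B"
    by (simp only: 1 B(2))
  also have "\<dots> = 0\<^sub>m p p" by (intro eq_matI) auto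
  finally show "Y * B + Yp * C \<in> tangent p n Y" by (auto simp: tangent_def intro!: carrier_matI)
qed

lemma tangent_components:
  assumes "\<xi> \<in> tangent p n Y"
  shows "Y\<^sup>T * \<xi> \<in> skew_mats p"
proof -
  have \<xi>: "\<xi> \<in> carrier_mat n p" and t: "\<xi>\<^sup>T * Y + Y\<^sup>T * \<xi> = 0\<^sub>m p p"
    using assms by (auto simp: tangent_def)
  have [simp]: "dim_row \<xi> = n" "dim_col \<xi> = p" using \<xi> by auto
  have "(Y\<^sup>T * \<xi>)\<^sup>T = \<xi>\<^sup>T * Y" by (simp add: mat_laws)
  moreover have "\<xi>\<^sup>T * Y = - (Y\<^sup>T * \<xi>)"
  proof (rule eq_matI, goal_cases)
    case (1 i j)
    thus ?case using arg_cong[OF t, of "\<lambda>M. M $$ (i, j)"] by (simp del: index_mult_mat(1))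
  qed auto
  ultimately show ?thesis by (auto simp: skew_mats_def intro!: carrier_matI)
qed

section \<open>Components of the ambient Hessian and the action of the block matrix\<close>

definition "Z l = Y\<^sup>T * A l * Y"
definition "Zp l = Y\<^sup>T * A l * Yp"
definition "Zpp l = Yp\<^sup>T * A l * Yp"

lemma Z_dim [simp]:
  "dim_row (Z l) = p" "dim_col (Z l) = p" "dim_row (Zp l) = p" "dim_col (Zp l) = q"
  "dim_row (Zpp l) = q" "dim_col (Zpp l) = q"
  by (simp_all add: Z_def Zp_def Zpp_def)

text \<open>The sum of these over \<open>l\<close>, times -4, is sym(Y^T E) for the ambient gradient
  E.\<close>

definition "gram_part l = sym_part (Z l * diag_part (Z l))"

lemma gram_part [simp]:
  "dim_row (gram_part l) = p" "dim_col (gram_part l) = p" "(gram_part l)\<^sup>T = gram_part l"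
  by (auto simp: gram_part_def intro!: sym_part_transpose)

text \<open>The Y-component of one summand of the Hessian before projection, without the factor -4.
  The first bracket matches \<open>H11\<close> applied to B, the second \<open>H12\<close> applied
  to C.\<close>

definition hess_top :: "real mat \<Rightarrow> real mat \<Rightarrow> nat \<Rightarrow> real mat" where
  "hess_top B C l = (Z l * B * diag_part (Z l) + 2 \<cdot>\<^sub>m (Z l * diag_part (Z l * B)) - B * gram_part l)
     + (Zp l * C * diag_part (Z l) + 2 \<cdot>\<^sub>m (Z l * diag_part (Zp l * C)))"

text \<open>The Yp-component of the same summand, grouped to match \<open>H21\<close> on B and
  \<open>H22\<close> on C.\<close>

definition hess_bottom :: "real mat \<Rightarrow> real mat \<Rightarrow> nat \<Rightarrow> real mat" where
  "hess_bottom B C l = ((Zp l)\<^sup>T * B * diag_part (Z l) + 2 \<cdot>\<^sub>m ((Zp l)\<^sup>T * diag_part (Z l * B)))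
     + (Zpp l * C * diag_part (Z l) + 2 \<cdot>\<^sub>m ((Zp l)\<^sup>T * diag_part (Zp l * C)) - C * gram_part l)"

lemma frame_components_ambient_hess:
  assumes B: "B \<in> skew_mats p" and C: "C \<in> carrier_mat q p"
  defines "\<xi> \<equiv> Y * B + Yp * C"
  defines "X \<equiv> euclidean_hess p n N A Y \<xi> - \<xi> * sym_part (Y\<^sup>T * euclidean_grad p n N A Y)"
  shows "Y\<^sup>T * X = (-4) \<cdot>\<^sub>m msum p p (hess_top B C) {1..N}"
    and "Yp\<^sup>T * X = (-4) \<cdot>\<^sub>m msum q p (hess_bottom B C) {1..N}"
proof -
  have [simp]: "dim_row B = p" "dim_col B = p" "dim_row C = q" "dim_col C = p"
    using skew_matsD(1)[OF B] C by auto
  have [simp]: "dim_row \<xi> = n" "dim_col \<xi> = p" by (simp_all add: \<xi>_def)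
  define h where "h l = A l * \<xi> * diag_part (Z l) + 2 \<cdot>\<^sub>m (A l * Y * diag_part (Y\<^sup>T * A l * \<xi>))" for l
  have "Y\<^sup>T * euclidean_grad p n N A Y = (-4) \<cdot>\<^sub>m (Y\<^sup>T * msum n p (\<lambda>l. A l * Y * diag_part (Z l)) {1..N})"
    by (simp add: euclidean_grad_def mult_smult_dim Z_def)
  also have "Y\<^sup>T * msum n p (\<lambda>l. A l * Y * diag_part (Z l)) {1..N} =
      msum p p (\<lambda>l. Y\<^sup>T * (A l * Y * diag_part (Z l))) {1..N}"
    by (subst mult_msum) (auto simp: A_dim intro!: carrier_matI)
  also have "\<dots> = msum p p (\<lambda>l. Z l * diag_part (Z l)) {1..N}"
    by (intro msum_cong) (simp add: Z_def mat_laws A_dim)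
  finally have "sym_part (Y\<^sup>T * euclidean_grad p n N A Y) = (-4) \<cdot>\<^sub>m msum p p gram_part {1..N}"
    by (simp add: sym_part_smult_msum gram_part_def[abs_def] carrier_matI)
  hence "\<xi> * sym_part (Y\<^sup>T * euclidean_grad p n N A Y) = (-4) \<cdot>\<^sub>m msum n p (\<lambda>l. \<xi> * gram_part l) {1..N}"
    by (simp add: mult_smult_dim mult_msum[of _ p _ _ p] carrier_matI)
  moreover have "euclidean_hess p n N A Y \<xi> = (-4) \<cdot>\<^sub>m msum n p h {1..N}"
    by (simp add: euclidean_hess_def h_def[abs_def] Z_def)
  ultimately have "X = (-4) \<cdot>\<^sub>m (msum n p h {1..N} - msum n p (\<lambda>l. \<xi> * gram_part l) {1..N})"
    unfolding X_def by (simp only:) (rule eq_matI, auto)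
  also have "msum n p h {1..N} - msum n p (\<lambda>l. \<xi> * gram_part l) {1..N} =
      msum n p (\<lambda>l. h l - \<xi> * gram_part l) {1..N}"
    by (rule msum_minus) (auto simp: h_def A_dim intro!: carrier_matI)
  finally have X: "X = (-4) \<cdot>\<^sub>m msum n p (\<lambda>l. h l - \<xi> * gram_part l) {1..N}" .
  have dim: "dim_row (h l) = n" "dim_col (h l) = p" if "l \<in> {1..N}" for l
    using that by (simp_all add: h_def A_dim)
  have top: "Y\<^sup>T * (h l - \<xi> * gram_part l) = hess_top B C l" if l: "l \<in> {1..N}" for l
  proof -
    have "Y\<^sup>T * (\<xi> * gram_part l) = Y\<^sup>T * \<xi> * gram_part l"
      by (rule mult_assoc_dim[symmetric]) auto
    hence "Y\<^sup>T * (\<xi> * gram_part l) = B * gram_part l"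
      by (simp only: \<xi>_def tangent_frame(2)[OF B C])
    moreover have "Y\<^sup>T * h l = (Z l * B + Zp l * C) * diag_part (Z l)
        + 2 \<cdot>\<^sub>m (Z l * diag_part (Z l * B + Zp l * C))"
      by (simp add: h_def \<xi>_def Z_def Zp_def mat_laws A_dim[OF l])
    ultimately have "Y\<^sup>T * (h l - \<xi> * gram_part l) = (Z l * B + Zp l * C) * diag_part (Z l)
        + 2 \<cdot>\<^sub>m (Z l * diag_part (Z l * B + Zp l * C)) - B * gram_part l"
      using dim[OF l] by (simp add: mult_minus_dim)
    also have "\<dots> = hess_top B C l"
      by (simp add: hess_top_def diag_part_add mat_laws)
        (rule eq_matI, auto simp: distrib_left simp del: index_mult_mat(1))
    finally show ?thesis .
  qed
  have bottom: "Yp\<^sup>T * (h l - \<xi> * gram_part l) = hess_bottom B C l" if l: "l \<in> {1..N}" for l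
  proof -
    have "Yp\<^sup>T * (\<xi> * gram_part l) = Yp\<^sup>T * \<xi> * gram_part l"
      by (rule mult_assoc_dim[symmetric]) auto
    hence "Yp\<^sup>T * (\<xi> * gram_part l) = C * gram_part l"
      by (simp only: \<xi>_def tangent_frame(3)[OF B C])
    \<comment> \<open>Symmetry of \<open>A l\<close> identifies Yp^T A Y with the transpose of
      \<open>Zp l\<close>.\<close>
    moreover have "Yp\<^sup>T * h l = ((Zp l)\<^sup>T * B + Zpp l * C) * diag_part (Z l)
        + 2 \<cdot>\<^sub>m ((Zp l)\<^sup>T * diag_part (Z l * B + Zp l * C))"
      by (simp add: h_def \<xi>_def Z_def Zp_def Zpp_def mat_laws A_dim[OF l] A_sym[OF l])
    ultimately have "Yp\<^sup>T * (h l - \<xi> * gram_part l) = ((Zp l)\<^sup>T * B + Zpp l * C) * diag_part (Z l)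
        + 2 \<cdot>\<^sub>m ((Zp l)\<^sup>T * diag_part (Z l * B + Zp l * C)) - C * gram_part l"
      using dim[OF l] by (simp add: mult_minus_dim)
    also have "\<dots> = hess_bottom B C l"
      by (simp add: hess_bottom_def diag_part_add mat_laws)
        (rule eq_matI, auto simp: distrib_left simp del: index_mult_mat(1))
    finally show ?thesis .
  qed
  have carr: "h l - \<xi> * gram_part l \<in> carrier_mat n p" if "l \<in> {1..N}" for l
    using dim[OF that] by (auto intro!: carrier_matI)
  have "Y\<^sup>T * msum n p (\<lambda>l. h l - \<xi> * gram_part l) {1..N} =
      msum p p (\<lambda>l. Y\<^sup>T * (h l - \<xi> * gram_part l)) {1..N}"
    by (subst mult_msum[OF _ carr]) auto
  also have "\<dots> = msum p p (hess_top B C) {1..N}" by (rule msum_cong) (rule top)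
  finally show "Y\<^sup>T * X = (-4) \<cdot>\<^sub>m msum p p (hess_top B C) {1..N}"
    by (simp add: X mult_smult_dim)
  have "Yp\<^sup>T * msum n p (\<lambda>l. h l - \<xi> * gram_part l) {1..N} =
      msum q p (\<lambda>l. Yp\<^sup>T * (h l - \<xi> * gram_part l)) {1..N}"
    by (subst mult_msum[OF _ carr]) auto
  also have "\<dots> = msum q p (hess_bottom B C) {1..N}" by (rule msum_cong) (rule bottom)
  finally show "Yp\<^sup>T * X = (-4) \<cdot>\<^sub>m msum q p (hess_bottom B C) {1..N}"
    by (simp add: X mult_smult_dim)
qed

text \<open>D veck B = vec B lets the blocks act on stacked matrices, where each Kronecker
  expression becomes a matrix formula. In the upper row D^T then antisymmetrises the sum of both
  contributions.\<close>

lemma HA_mult_vec: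
  assumes B: "B \<in> skew_mats p" and C: "C \<in> carrier_mat q p"
  defines "M \<equiv> msum p p (hess_top B C) {1..N}"
  shows "HA p n N A Y Yp *\<^sub>v (veck B @\<^sub>v mvec C) =
    veck ((-2) \<cdot>\<^sub>m (M - M\<^sup>T)) @\<^sub>v mvec ((-4) \<cdot>\<^sub>m msum q p (hess_bottom B C) {1..N})"
proof -
  note Bc = skew_matsD(1)[OF B]
  have [simp]: "dim_row B = p" "dim_col B = p" "dim_row C = q" "dim_col C = p"
    using Bc C by auto
  have [simp]: "dim_vec (veck B) = p * (p - 1) div 2" by (rule veck_dim[OF Bc])
  have HA: "HA p n N A Y Yp =
      four_block_mat (H11 p N Z) (H12 p q N Z Zp) (H21 p q N Z Zp) (H22 p q N Z Zp Zpp)"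
    by (simp add: HA_def Let_def n_eq Z_def[abs_def] Zp_def[abs_def] Zpp_def[abs_def])
  have [intro!]: "Z l \<in> carrier_mat p p" "Zp l \<in> carrier_mat p q" "Zpp l \<in> carrier_mat q q"
    "gram_part l \<in> carrier_mat p p" for l by (auto intro!: carrier_matI)

  let ?F11 = "\<lambda>l. diag_part (Z l) \<otimes>\<^sub>k Z l + 2 \<cdot>\<^sub>m ((1\<^sub>m p \<otimes>\<^sub>k Z l) * Delta p * (1\<^sub>m p \<otimes>\<^sub>k Z l))
       - sym_part (Z l * diag_part (Z l)) \<otimes>\<^sub>k 1\<^sub>m p"
  let ?G11 = "\<lambda>l. Z l * B * diag_part (Z l) + 2 \<cdot>\<^sub>m (Z l * diag_part (Z l * B)) - B * gram_part l"
  have e11: "?F11 l *\<^sub>v mvec B = mvec (?G11 l)" for l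
  proof -
    have 1: "(diag_part (Z l) \<otimes>\<^sub>k Z l + 2 \<cdot>\<^sub>m ((1\<^sub>m p \<otimes>\<^sub>k Z l) * Delta p * (1\<^sub>m p \<otimes>\<^sub>k Z l))) *\<^sub>v mvec B =
        mvec (Z l * B * diag_part (Z l) + 2 \<cdot>\<^sub>m (Z l * diag_part (Z l * B)))"
      by (rule hessian_kron_mult_mvec) (use Bc in auto)
    have 2: "(sym_part (Z l * diag_part (Z l)) \<otimes>\<^sub>k 1\<^sub>m p) *\<^sub>v mvec B = mvec (B * gram_part l)"
      unfolding gram_part_def[symmetric] by (rule kron_one_mult_mvec) (use Bc in auto)
    show ?thesis
      by (subst minus_mult_vec_dim) (simp_all add: 1 2 mvec_minus mult.commute)
  qed
  have K11: "msum (p * p) (p * p) ?F11 {1..N} *\<^sub>v mvec B = mvec (msum p p ?G11 {1..N})"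
    by (rule msum_mult_mvec[OF Bc _ _ e11]) (auto intro!: carrier_matI)

  let ?F12 = "\<lambda>l. diag_part (Z l) \<otimes>\<^sub>k Zp l + 2 \<cdot>\<^sub>m ((1\<^sub>m p \<otimes>\<^sub>k Z l) * Delta p * (1\<^sub>m p \<otimes>\<^sub>k Zp l))"
  let ?G12 = "\<lambda>l. Zp l * C * diag_part (Z l) + 2 \<cdot>\<^sub>m (Z l * diag_part (Zp l * C))"
  have e12: "?F12 l *\<^sub>v mvec C = mvec (?G12 l)" for l
    using hessian_kron_mult_mvec[of "Z l" p "Zp l" p q "Z l" "Zp l" C] C by auto
  have K12: "msum (p * p) (p * q) ?F12 {1..N} *\<^sub>v mvec C = mvec (msum p p ?G12 {1..N})"
    by (rule msum_mult_mvec[OF C _ _ e12]) (auto intro!: carrier_matI)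

  let ?F21 = "\<lambda>l. diag_part (Z l) \<otimes>\<^sub>k (Zp l)\<^sup>T
    + 2 \<cdot>\<^sub>m ((1\<^sub>m p \<otimes>\<^sub>k (Zp l)\<^sup>T) * Delta p * (1\<^sub>m p \<otimes>\<^sub>k Z l))"
  let ?G21 = "\<lambda>l. (Zp l)\<^sup>T * B * diag_part (Z l) + 2 \<cdot>\<^sub>m ((Zp l)\<^sup>T * diag_part (Z l * B))"
  have e21: "?F21 l *\<^sub>v mvec B = mvec (?G21 l)" for l
    using hessian_kron_mult_mvec[of "Z l" p "(Zp l)\<^sup>T" q p "(Zp l)\<^sup>T" "Z l" B] Bc by auto
  have K21: "msum (p * q) (p * p) ?F21 {1..N} *\<^sub>v mvec B = mvec (msum q p ?G21 {1..N})"
    by (rule msum_mult_mvec[OF Bc _ _ e21]) (auto intro!: carrier_matI)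

  let ?F22 = "\<lambda>l. diag_part (Z l) \<otimes>\<^sub>k Zpp l
       + 2 \<cdot>\<^sub>m ((1\<^sub>m p \<otimes>\<^sub>k (Zp l)\<^sup>T) * Delta p * (1\<^sub>m p \<otimes>\<^sub>k Zp l))
       - sym_part (Z l * diag_part (Z l)) \<otimes>\<^sub>k 1\<^sub>m q"
  let ?G22 = "\<lambda>l. Zpp l * C * diag_part (Z l) + 2 \<cdot>\<^sub>m ((Zp l)\<^sup>T * diag_part (Zp l * C)) - C * gram_part l"
  have e22: "?F22 l *\<^sub>v mvec C = mvec (?G22 l)" for l
  proof -
    have 1: "(diag_part (Z l) \<otimes>\<^sub>k Zpp l + 2 \<cdot>\<^sub>m ((1\<^sub>m p \<otimes>\<^sub>k (Zp l)\<^sup>T) * Delta p * (1\<^sub>m p \<otimes>\<^sub>k Zp l))) *\<^sub>v mvec C =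
        mvec (Zpp l * C * diag_part (Z l) + 2 \<cdot>\<^sub>m ((Zp l)\<^sup>T * diag_part (Zp l * C)))"
      by (rule hessian_kron_mult_mvec) (use C in auto)
    have 2: "(sym_part (Z l * diag_part (Z l)) \<otimes>\<^sub>k 1\<^sub>m q) *\<^sub>v mvec C = mvec (C * gram_part l)"
      unfolding gram_part_def[symmetric] by (rule kron_one_mult_mvec) (use C in auto)
    show ?thesis
      by (subst minus_mult_vec_dim) (simp_all add: 1 2 mvec_minus mult.commute)
  qed
  have K22: "msum (p * q) (p * q) ?F22 {1..N} *\<^sub>v mvec C = mvec (msum q p ?G22 {1..N})"
    by (rule msum_mult_mvec[OF C _ _ e22]) (auto intro!: carrier_matI)

  have M: "msum p p ?G11 {1..N} + msum p p ?G12 {1..N} = M"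
    unfolding M_def hess_top_def[abs_def] by (rule msum_add) (auto intro!: carrier_matI)
  have M': "msum q p ?G21 {1..N} + msum q p ?G22 {1..N} = msum q p (hess_bottom B C) {1..N}"
    unfolding hess_bottom_def[abs_def] by (rule msum_add) (auto intro!: carrier_matI)
  have Mc: "M \<in> carrier_mat p p" "M - M\<^sup>T \<in> carrier_mat p p" by (auto simp: M_def intro!: carrier_matI)

  have "H11 p N Z *\<^sub>v veck B + H12 p q N Z Zp *\<^sub>v mvec C =
      (-2) \<cdot>\<^sub>v ((Dmat p)\<^sup>T *\<^sub>v mvec (msum p p ?G11 {1..N}))
      + (-2) \<cdot>\<^sub>v ((Dmat p)\<^sup>T *\<^sub>v mvec (msum p p ?G12 {1..N}))"
    by (simp add: H11_def H12_def smult_mult_vec_dim mult_mat_vec_assoc_dim Dmat_mult_veck[OF B]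
        K11 K12 mult.commute[of q] del: One_nat_def)
  also have "\<dots> = (-2) \<cdot>\<^sub>v ((Dmat p)\<^sup>T *\<^sub>v (mvec (msum p p ?G11 {1..N}) + mvec (msum p p ?G12 {1..N})))"
    by (subst mult_add_vec_dim) (auto intro!: eq_vecI simp: distrib_left)
  also have "\<dots> = (-2) \<cdot>\<^sub>v ((Dmat p)\<^sup>T *\<^sub>v mvec M)"
    by (simp add: mvec_add flip: M)
  also have "\<dots> = veck ((-2) \<cdot>\<^sub>m (M - M\<^sup>T))"
    using Mc by (simp add: Dmat_transpose_mult_mvec veck_smult)
  finally have top: "H11 p N Z *\<^sub>v veck B + H12 p q N Z Zp *\<^sub>v mvec C = veck ((-2) \<cdot>\<^sub>m (M - M\<^sup>T))" .

  have "H21 p q N Z Zp *\<^sub>v veck B + H22 p q N Z Zp Zpp *\<^sub>v mvec C =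
      (-4) \<cdot>\<^sub>v mvec (msum q p ?G21 {1..N}) + (-4) \<cdot>\<^sub>v mvec (msum q p ?G22 {1..N})"
    by (simp add: H21_def H22_def smult_mult_vec_dim mult_mat_vec_assoc_dim Dmat_mult_veck[OF B]
        K21 K22 mult.commute[of q] del: One_nat_def)
  also have "\<dots> = (-4) \<cdot>\<^sub>v (mvec (msum q p ?G21 {1..N}) + mvec (msum q p ?G22 {1..N}))"
    by (auto intro!: eq_vecI simp: distrib_left)
  also have "\<dots> = mvec ((-4) \<cdot>\<^sub>m msum q p (hess_bottom B C) {1..N})"
    by (simp add: mvec_add mvec_smult del: One_nat_def flip: M')
  finally have bottom: "H21 p q N Z Zp *\<^sub>v veck B + H22 p q N Z Zp Zpp *\<^sub>v mvec C =
      mvec ((-4) \<cdot>\<^sub>m msum q p (hess_bottom B C) {1..N})" .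

  show ?thesis
    unfolding HA top[symmetric] bottom[symmetric]
    by (rule four_block_mat_mult_vec[of _ "p * (p - 1) div 2" "p * (p - 1) div 2" _ "p * q" _ "p * q"])
      (auto simp: H11_def H12_def H21_def H22_def mult.commute[of q] intro!: carrier_matI carrier_vecI)
qed

section \<open>Newton's equation in coordinates\<close>

abbreviation "grad \<equiv> rgrad p n (jd_cost N A) Y"
abbreviation "hess \<equiv> rhess p n (jd_cost N A) Y"

lemma grad_tangent: "grad \<in> tangent p n Y"
  unfolding rgrad_eq[OF Y] by (rule proj_tangent[OF Y]) (auto intro: carrier_matI)

lemma hess_tangent:
  assumes "\<xi> \<in> tangent p n Y"
  shows "hess \<xi> \<in> tangent p n Y"
  unfolding rhess_eq[OF Y assms]
  by (rule proj_tangent[OF Y]) (use assms in \<open>auto simp: tangent_def intro!: carrier_matI\<close>)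

text \<open>In the Y-component the projection turns -4 M into -4 (M - M^T)/2, in agreement with the
  upper blocks. In the other component the correction Y sym(...) vanishes because Yp^T Y =
  0.\<close>

lemma HA_hess:
  assumes B: "B \<in> skew_mats p" and C: "C \<in> carrier_mat q p"
  defines "\<xi> \<equiv> Y * B + Yp * C"
  shows "HA p n N A Y Yp *\<^sub>v (veck B @\<^sub>v mvec C) = veck (Y\<^sup>T * hess \<xi>) @\<^sub>v mvec (Yp\<^sup>T * hess \<xi>)"
proof -
  have \<xi>: "\<xi> \<in> tangent p n Y" unfolding \<xi>_def by (rule tangent_frame(1)[OF B C])
  hence [simp]: "dim_row \<xi> = n" "dim_col \<xi> = p" by (auto simp: tangent_def)
  define X where "X = euclidean_hess p n N A Y \<xi> - \<xi> * sym_part (Y\<^sup>T * euclidean_grad p n N A Y)"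
  define M where "M = msum p p (hess_top B C) {1..N}"
  have X: "X \<in> carrier_mat n p" by (auto simp: X_def intro!: carrier_matI)
  hence [simp]: "dim_row X = n" "dim_col X = p" by auto
  have hess: "hess \<xi> = proj Y X" unfolding X_def by (rule rhess_eq[OF Y \<xi>])
  note comp = frame_components_ambient_hess[OF B C, folded \<xi>_def, folded X_def, folded M_def]
  have "Y\<^sup>T * hess \<xi> = (-2) \<cdot>\<^sub>m (M - M\<^sup>T)"
    unfolding hess transpose_mult_proj[OF Y X] comp(1)
    by (rule eq_matI) (auto simp: M_def right_diff_distrib)
  moreover have "Yp\<^sup>T * hess \<xi> = Yp\<^sup>T * X"
    unfolding hess proj_def by (simp add: mult_minus_dim frame_cancel) (rule eq_matI, auto)
  ultimately show ?thesis
    using HA_mult_vec[OF B C, folded M_def] comp(2) by simp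
qed

text \<open>A matrix is determined by its two frame components, and \<open>veck\<close> loses
  nothing on the first one, because Y^T times a tangent vector is skew-symmetric and both the
  Hessian value and the gradient are tangent.\<close>

lemma newton_iff:
  assumes B: "B \<in> skew_mats p" and C: "C \<in> carrier_mat q p"
  shows "hess (Y * B + Yp * C) = - grad \<longleftrightarrow>
    HA p n N A Y Yp *\<^sub>v (veck B @\<^sub>v mvec C) = - (veck (Y\<^sup>T * grad) @\<^sub>v mvec (Yp\<^sup>T * grad))"
proof -
  let ?H = "hess (Y * B + Yp * C)"
  have H: "?H \<in> tangent p n Y" by (intro hess_tangent tangent_frame(1) B C)
  note skew = tangent_components[OF H] tangent_components[OF grad_tangent]
  have [simp]: "dim_row ?H = n" "dim_col ?H = p" "dim_row grad = n" "dim_col grad = p"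
    using H grad_tangent by (auto simp: tangent_def)
  have carr: "Y\<^sup>T * grad \<in> carrier_mat p p" "Y\<^sup>T * ?H \<in> carrier_mat p p"
      "Yp\<^sup>T * ?H \<in> carrier_mat q p" "- (Yp\<^sup>T * grad) \<in> carrier_mat q p"
    by (auto intro!: carrier_matI)
  have skew': "- (Y\<^sup>T * grad) \<in> skew_mats p"
    using skew(2) by (auto simp: skew_mats_def transpose_uminus)
  have neg: "- (veck (Y\<^sup>T * grad) @\<^sub>v mvec (Yp\<^sup>T * grad)) = veck (- (Y\<^sup>T * grad)) @\<^sub>v mvec (- (Yp\<^sup>T * grad))"
    unfolding veck_uminus[OF carr(1)] mvec_uminus by (rule eq_vecI) auto
  show ?thesis
  proof
    assume "?H = - grad"
    thus "HA p n N A Y Yp *\<^sub>v (veck B @\<^sub>v mvec C) = - (veck (Y\<^sup>T * grad) @\<^sub>v mvec (Yp\<^sup>T * grad))"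
      unfolding HA_hess[OF B C] neg by (simp add: mult_uminus_dim)
  next
    assume "HA p n N A Y Yp *\<^sub>v (veck B @\<^sub>v mvec C) = - (veck (Y\<^sup>T * grad) @\<^sub>v mvec (Yp\<^sup>T * grad))"
    hence "veck (Y\<^sup>T * ?H) = veck (- (Y\<^sup>T * grad)) \<and> mvec (Yp\<^sup>T * ?H) = mvec (- (Yp\<^sup>T * grad))"
      unfolding HA_hess[OF B C] neg
      by (subst (asm) append_vec_eq[where n = "p * (p - 1) div 2"])
        (rule veck_carrier[OF carr(2)], rule veck_carrier[OF skew_matsD(1)[OF skew']])
    hence "Y\<^sup>T * ?H = - (Y\<^sup>T * grad)" "Yp\<^sup>T * ?H = - (Yp\<^sup>T * grad)"
      using veck_inject[OF skew(1) skew'] mvec_inject[OF carr(3,4)] by auto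
    hence "Y\<^sup>T * ?H = Y\<^sup>T * (- grad)" "Yp\<^sup>T * ?H = Yp\<^sup>T * (- grad)"
      by (simp_all add: mult_uminus_dim)
    hence "Y * (Y\<^sup>T * ?H) + Yp * (Yp\<^sup>T * ?H) = Y * (Y\<^sup>T * (- grad)) + Yp * (Yp\<^sup>T * (- grad))" by simp
    thus "?H = - grad"
      by (subst (asm) frame_decompose[of _ p, symmetric], auto intro!: carrier_matI,
          subst (asm) frame_decompose[of _ p, symmetric], auto intro!: carrier_matI)
  qed
qed

lemma newton_solution:
  assumes inv: "invertible_mat (HA p n N A Y Yp)"
  shows "\<exists>B C. B \<in> skew_mats p \<and> C \<in> carrier_mat q p \<and>
    veck B @\<^sub>v mvec C = - (the (mat_inverse (HA p n N A Y Yp)) *\<^sub>v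
      (veck (Y\<^sup>T * grad) @\<^sub>v mvec (Yp\<^sup>T * grad))) \<and>
    {\<xi> \<in> tangent p n Y. hess \<xi> = - grad} = {Y * B + Yp * C}"
proof -
  let ?H = "HA p n N A Y Yp"
  define k where "k = p * (p - 1) div 2"
  define d where "d = k + p * q"
  have H: "?H \<in> carrier_mat d d"
    by (auto simp: HA_def Let_def H11_def H22_def d_def k_def n_eq intro!: carrier_matI)
  obtain G where G: "?H * G = 1\<^sub>m d" "G * ?H = 1\<^sub>m d" "G \<in> carrier_mat d d"
  proof -
    from inv obtain G where "?H * G = 1\<^sub>m (dim_row ?H)" "G * ?H = 1\<^sub>m (dim_row G)"
      by (auto simp: invertible_mat_def inverts_mat_def)
    moreover from this have "G \<in> carrier_mat d d"
      using H by (metis carrier_matD carrier_matI index_mult_mat(2,3) index_one_mat(2,3))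
    ultimately show ?thesis using that H by auto
  qed
  \<comment> \<open>\<open>invertible_mat\<close> supplies some inverse, whereas
    \<open>mat_inverse\<close> is an algorithm with an optional result; being a unit of the matrix
    ring excludes \<open>None\<close>.\<close>
  hence "?H \<in> Units (ring_mat TYPE(real) d ())"
    using H by (auto simp: Units_def ring_mat_def)
  then obtain HI where HI_eq: "mat_inverse ?H = Some HI"
    using mat_inverse(1)[OF H, of "()"] by (cases "mat_inverse ?H") auto
  have HI: "?H * HI = 1\<^sub>m d" "HI * ?H = 1\<^sub>m d" "HI \<in> carrier_mat d d"
    using mat_inverse(2)[OF H HI_eq] by auto
  define b where "b = veck (Y\<^sup>T * grad) @\<^sub>v mvec (Yp\<^sup>T * grad)"
  have [simp]: "dim_row grad = n" "dim_col grad = p"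
    using grad_tangent by (auto simp: tangent_def)
  have "Y\<^sup>T * grad \<in> carrier_mat p p" by (auto intro!: carrier_matI)
  from veck_dim[OF this] have b: "b \<in> carrier_vec d"
    by (auto simp: b_def d_def k_def mult.commute intro!: carrier_vecI)
  define x where "x = - (HI *\<^sub>v b)"
  have x: "x \<in> carrier_vec d" using mult_mat_vec_carrier[OF HI(3) b] by (simp add: x_def)
  have Hx: "?H *\<^sub>v x = - b"
  proof -
    have "- (HI *\<^sub>v b) = HI *\<^sub>v (- b)"
      using HI(3) b by (intro eq_vecI) (auto simp: scalar_prod_def sum_negf)
    hence "?H *\<^sub>v x = (?H * HI) *\<^sub>v (- b)"
      using H HI(3) b by (simp add: x_def mult_mat_vec_assoc_dim)
    thus ?thesis using b by (simp add: HI(1))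
  qed
  have unique: "y = x" if "y \<in> carrier_vec d" "?H *\<^sub>v y = - b" for y
  proof -
    have "z = HI *\<^sub>v (?H *\<^sub>v z)" if "z \<in> carrier_vec d" for z
      using that H HI by (simp flip: mult_mat_vec_assoc_dim)
    with that x Hx show ?thesis by metis
  qed
  \<comment> \<open>Every vector of length \<open>d\<close> is a coordinate vector: its first
    \<open>k\<close> entries come from a skew-symmetric matrix, the remaining \<open>p * q\<close>
    from a stacked one.\<close>
  have split: "x = vec_first x k @\<^sub>v vec_last x (p * q)"
    using x by (simp add: d_def)
  obtain B where B: "B \<in> skew_mats p" "veck B = vec_first x k"
    using veck_surj[of "vec_first x k" p] by (auto simp: k_def)
  obtain C where C: "C \<in> carrier_mat q p" "mvec C = vec_last x (p * q)"
    using mvec_surj[of "vec_last x (p * q)" p q] by auto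
  have BC: "veck B @\<^sub>v mvec C = x" using split B C by simp
  have "{\<xi> \<in> tangent p n Y. hess \<xi> = - grad} = {Y * B + Yp * C}"
  proof (intro equalityI subsetI)
    fix \<xi> assume "\<xi> \<in> {Y * B + Yp * C}"
    moreover have "hess (Y * B + Yp * C) = - grad"
      unfolding newton_iff[OF B(1) C(1)] BC Hx b_def ..
    ultimately show "\<xi> \<in> {\<xi> \<in> tangent p n Y. hess \<xi> = - grad}"
      using tangent_frame(1)[OF B(1) C(1)] by simp
  next
    \<comment> \<open>Any tangent solution can be written in the frame, so uniqueness for the linear
      system transfers to Newton's equation.\<close>
    fix \<xi> assume "\<xi> \<in> {\<xi> \<in> tangent p n Y. hess \<xi> = - grad}"
    hence \<xi>: "\<xi> \<in> tangent p n Y" "hess \<xi> = - grad" by auto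
    define B' C' where "B' = Y\<^sup>T * \<xi>" and "C' = Yp\<^sup>T * \<xi>"
    have dec: "\<xi> = Y * B' + Yp * C'"
      unfolding B'_def C'_def by (rule frame_decompose) (use \<xi> in \<open>auto simp: tangent_def\<close>)
    have B': "B' \<in> skew_mats p" unfolding B'_def by (rule tangent_components[OF \<xi>(1)])
    have C': "C' \<in> carrier_mat q p"
      using \<xi>(1) by (auto simp: C'_def tangent_def intro!: carrier_matI)
    have "?H *\<^sub>v (veck B' @\<^sub>v mvec C') = - b"
      using newton_iff[OF B' C'] \<xi>(2) dec by (simp add: b_def)
    moreover have "veck B' @\<^sub>v mvec C' \<in> carrier_vec d"
      using veck_carrier[OF skew_matsD(1)[OF B']] mvec_carrier[OF C'] by (simp add: d_def k_def)
    ultimately have "veck B' @\<^sub>v mvec C' = veck B @\<^sub>v mvec C" using unique BC by simp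
    hence "veck B' = veck B \<and> mvec C' = mvec C"
      using veck_carrier[OF skew_matsD(1)[OF B']] veck_carrier[OF skew_matsD(1)[OF B(1)]]
      by (subst (asm) append_vec_eq)
    hence "B' = B" "C' = C"
      using veck_inject[OF B' B(1)] mvec_inject[OF C' C(1)] by auto
    with dec show "\<xi> \<in> {Y * B + Yp * C}" by simp
  qed
  with B(1) C(1) BC show ?thesis
    unfolding HI_eq option.sel x_def b_def by blast
qed

end

theorem mainTheorem2:
  fixes p n N :: nat and A :: "nat \<Rightarrow> real mat" and Y Yp :: "real mat"
  assumes "1 \<le> p" and "p \<le> n"
    and "\<And>l. l \<in> {1..N} \<Longrightarrow> A l \<in> carrier_mat n n \<and> (A l)\<^sup>T = A l"
    and "Y \<in> stiefel p n"
    and "Yp \<in> carrier_mat n (n - p)"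
    and "Y\<^sup>T * Yp = 0\<^sub>m p (n - p)"
    and "Yp\<^sup>T * Yp = 1\<^sub>m (n - p)"
  shows
    "(\<forall>B C. B \<in> skew_mats p \<longrightarrow> C \<in> carrier_mat (n - p) p \<longrightarrow>
        (rhess p n (jd_cost N A) Y (Y * B + Yp * C) = - rgrad p n (jd_cost N A) Y \<longleftrightarrow>
         HA p n N A Y Yp *\<^sub>v (veck B @\<^sub>v mvec C) =
           - (veck (Y\<^sup>T * rgrad p n (jd_cost N A) Y) @\<^sub>v mvec (Yp\<^sup>T * rgrad p n (jd_cost N A) Y))))
     \<and> (invertible_mat (HA p n N A Y Yp) \<longrightarrow>
        (\<exists>B C. B \<in> skew_mats p \<and> C \<in> carrier_mat (n - p) p \<and>
           veck B @\<^sub>v mvec C = - (the (mat_inverse (HA p n N A Y Yp)) *\<^sub>v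
             (veck (Y\<^sup>T * rgrad p n (jd_cost N A) Y) @\<^sub>v mvec (Yp\<^sup>T * rgrad p n (jd_cost N A) Y))) \<and>
           {\<xi> \<in> tangent p n Y. rhess p n (jd_cost N A) Y \<xi> = - rgrad p n (jd_cost N A) Y}
             = {Y * B + Yp * C}))"
proof -
  \<comment> \<open>The hypothesis \<open>p \<le> n\<close> gives \<open>n = p + (n - p)\<close>
    despite truncated subtraction.\<close>
  interpret stiefel_frame n N A p "n - p" Y Yp
    using assms by unfold_locales auto
  show ?thesis using newton_iff newton_solution by blast
qed

end
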